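(* Let $(M,\lambda_{(i)}(x,y))$ be a GAP-space equipped with a non-linear connection $N^\alpha_\mu$, and let $|$, $||$ be the $h$- and $v$-covariant derivatives of its canonical $d$-connection. Let $\widetilde H$, $\widetilde V$ be the $hW$- and $vW$-tensors of the dual $d$-connection, and $\widehat H$, $\mathring H$ the $hW$-tensors of the symmetric and Riemannian $d$-connections. Let $\widetilde{\mathcal H}_{\nu\sigma}:=\widetilde H^\alpha_{\alpha\nu\sigma}$, $\widehat{\mathcal H}_{\nu\sigma}:=\widehat H^\alpha_{\alpha\nu\sigma}$, $\mathring{\mathcal H}_{\nu\sigma}:=\mathring H^\alpha_{\alpha\nu\sigma}$ and $\widetilde{\mathcal V}_{\nu\sigma}:=\widetilde V^\alpha_{\alpha\nu\sigma}$. Then (a) $\widetilde{\mathcal H}_{\nu\sigma}=\beta_{\sigma|\nu}-\beta_{\nu|\sigma}+2\beta_\epsilon\Lambda^\epsilon_{\sigma\nu}$; (b) $\widetilde{\mathcal V}_{\nu\sigma}=B_{\sigma||\nu}-B_{\nu||\sigma}+2B_\epsilon T^\epsilon_{\sigma\nu}$; (c) $\widehat{\mathcal H}_{\nu\sigma}=\tfrac12\{\widetilde{\mathcal H}_{\nu\sigma}+\beta_\epsilon\Lambda^\epsilon_{\nu\sigma}\}$; (d) $\mathring{\mathcal H}_{\nu\sigma}=0$.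
   Context: $M$ is a $C^\infty$ manifold of dimension $n$, $\pi:TM\to M$ its tangent bundle with induced local coordinates $(x^\mu,y^\mu)$; $\partial_\mu=\partial/\partial x^\mu$, $\dot\partial_\mu=\partial/\partial y^\mu$. All objects are smooth in $(x,y)$. Summation convention on repeated Greek and repeated Latin indices. A non-linear connection is a system of functions $N^\alpha_\beta(x,y)$ on induced charts of $TM$ transforming by $N^{\alpha'}_{\beta'}=p^{\alpha'}_{\alpha}p^{\beta}_{\beta'}N^\alpha_\beta+p^{\alpha'}_{\epsilon}p^{\epsilon}_{\beta'\sigma'}y^{\sigma'}$, where $p^{\alpha'}_{\alpha}=\partial x^{\alpha'}/\partial x^{\alpha}$, $p^{\epsilon}_{\beta'\sigma'}=\partial^2x^\epsilon/\partial x^{\beta'}\partial x^{\sigma'}$; set $\delta_\mu=\partial_\mu-N^\alpha_\mu\dot\partial_\alpha$. A GAP-space is a manifold $M$ together with $n$ global linearly independent sections $\lambda_{(i)}=(\lambda_{(i)}^\alpha(x,y))$ of the pullback bundle $\pi^{-1}(TM)$; $(\lambda_{(i)\alpha})$ is the inverse matrix ($\lambda_{(i)}^\alpha\lambda_{(i)\beta}=\delta^\alpha_\beta$, $\lambda_{(i)}^\alpha\lambda_{(j)\alpha}=\delta_{ij}$), and $g_{\mu\nu}=\lambda_{(i)\mu}\lambda_{(i)\nu}$ its metric, with inverse $g^{\mu\nu}$. $d$-connections (all with the same $N$): - canonical $D=(N,\Gamma,C)$: $\Gamma^\alpha_{\mu\nu}=\lambda_{(i)}^\alpha\delta_\nu\lambda_{(i)\mu}$,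 $C^\alpha_{\mu\nu}=\lambda_{(i)}^\alpha\dot\partial_\nu\lambda_{(i)\mu}$; - Riemannian $\mathring D=(N,\mathring\Gamma,\mathring C)$: $\mathring\Gamma^\alpha_{\mu\nu}=\tfrac12g^{\alpha\epsilon}(\delta_\mu g_{\nu\epsilon}+\delta_\nu g_{\mu\epsilon}-\delta_\epsilon g_{\mu\nu})$, $\mathring C^\alpha_{\mu\nu}=\tfrac12g^{\alpha\epsilon}(\dot\partial_\mu g_{\nu\epsilon}+\dot\partial_\nu g_{\mu\epsilon}-\dot\partial_\epsilon g_{\mu\nu})$; - dual $\widetilde D=(N,\widetilde\Gamma,\widetilde C)$: $\widetilde\Gamma^\alpha_{\mu\nu}=\Gamma^\alpha_{\nu\mu}$, $\widetilde C^\alpha_{\mu\nu}=C^\alpha_{\nu\mu}$; - symmetric $\widehat D=(N,\widehat\Gamma,\widehat C)$: $\widehat\Gamma^\alpha_{\mu\nu}=\tfrac12(\Gamma^\alpha_{\mu\nu}+\Gamma^\alpha_{\nu\mu})$, $\widehat C^\alpha_{\mu\nu}=\tfrac12(C^\alpha_{\mu\nu}+C^\alpha_{\nu\mu})$. For a $d$-connection $(N,\Gamma,C)$ the $h$- and $v$-covariant derivatives are $A^\alpha_{\mu|\nu}=\delta_\nu A^\alpha_\mu+A^\epsilon_\mu\Gamma^\alpha_{\epsilon\nu}-A^\alpha_\epsilon\Gamma^\epsilon_{\mu\nu}$, $A^\alpha_{\mu||\nu}=\dot\partial_\nu A^\alpha_\mu+A^\epsilon_\mu C^\alpha_{\epsilon\nu}-A^\alpha_\epsilon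 C^\epsilon_{\mu\nu}$ (similarly for other tensor types); $X_{\mu|\nu\sigma}:=(X_{\mu|\nu})_{|\sigma}$, $X_{\mu||\nu\sigma}:=(X_{\mu||\nu})_{||\sigma}$. Its $hW$-tensor $H^\alpha_{\mu\nu\sigma}$ and $vW$-tensor $V^\alpha_{\mu\nu\sigma}$ are defined by requiring, for every $i$, $$\lambda_{(i)\mu|\nu\sigma}-\lambda_{(i)\mu|\sigma\nu}=\lambda_{(i)\epsilon}H^\epsilon_{\mu\nu\sigma},\qquad \lambda_{(i)\mu||\nu\sigma}-\lambda_{(i)\mu||\sigma\nu}=\lambda_{(i)\epsilon}V^\epsilon_{\mu\nu\sigma},$$ with covariant derivatives taken with respect to that $d$-connection. The $W$-tensors of $\widetilde D,\widehat D,\mathring D$ carry the corresponding decoration. Tensors of the canonical $d$-connection: $\Lambda^\alpha_{\mu\nu}=\Gamma^\alpha_{\mu\nu}-\Gamma^\alpha_{\nu\mu}$, $T^\alpha_{\mu\nu}=C^\alpha_{\mu\nu}-C^\alpha_{\nu\mu}$, $\beta_\mu=\Lambda^\epsilon_{\mu\epsilon}$, $B_\mu=T^\epsilon_{\mu\epsilon}$. *)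

theory Defs
  imports "HOL-Analysis.Analysis"
begin

section \<open>Smooth manifolds and the tangent bundle\<close>

text \<open>The predicate \<open>smooth_on\<close> is meant for open sets; all iterated directional derivatives are
  required to exist (as Frechet derivatives) and to be continuous.\<close>

primrec times_differentiable_on ::
    "nat \<Rightarrow> 'a::real_normed_vector set \<Rightarrow> ('a \<Rightarrow> 'b::real_normed_vector) \<Rightarrow> bool" where
  "times_differentiable_on 0 S f \<longleftrightarrow> continuous_on S f"
| "times_differentiable_on (Suc k) S f \<longleftrightarrow>
     (\<forall>x\<in>S. f differentiable (at x)) \<and>
     (\<forall>v. times_differentiable_on k S (\<lambda>x. frechet_derivative f (at x) v))"

definition smooth_on :: "'a::real_normed_vector set \<Rightarrow> ('a \<Rightarrow> 'b::real_normed_vector) \<Rightarrow> bool" where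
  "smooth_on S f \<longleftrightarrow> (\<forall>k. times_differentiable_on k S f)"

text \<open>A chart is a pair of a domain and a coordinate map; the dimension of the manifold is
  \<open>CARD('n)\<close>.\<close>

type_synonym ('m, 'n) chart = "'m set \<times> ('m \<Rightarrow> real ^ 'n)"

definition is_chart :: "'m topology \<Rightarrow> ('m, 'n::finite) chart \<Rightarrow> bool" where
  "is_chart M c \<longleftrightarrow> openin M (fst c) \<and> open (snd c ` fst c) \<and>
     homeomorphic_map (subtopology M (fst c)) (top_of_set (snd c ` fst c)) (snd c)"

definition transition :: "('m, 'n::finite) chart \<Rightarrow> ('m, 'n) chart \<Rightarrow> real ^ 'n \<Rightarrow> real ^ 'n" where
  "transition c c' = snd c' \<circ> inv_into (fst c) (snd c)"

definition smooth_manifold :: "'m topology \<Rightarrow> ('m, 'n::finite) chart set \<Rightarrow> bool" where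
  "smooth_manifold M A \<longleftrightarrow> Hausdorff_space M \<and> second_countable M \<and>
     (\<forall>c\<in>A. is_chart M c) \<and> (\<Union>c\<in>A. fst c) = topspace M \<and>
     (\<forall>c\<in>A. \<forall>c'\<in>A. smooth_on (snd c ` (fst c \<inter> fst c')) (transition c c'))"

text \<open>With unprimed coordinates \<open>x\<close> given by \<open>c\<close> and primed coordinates \<open>x'\<close> given by \<open>c'\<close>,
  \<open>jac c c' x $ a $ b\<close> is the derivative of \<open>x'\<^sup>a\<close> with respect to \<open>x\<^sup>b\<close>, and
  \<open>jac2 c c' a b s x\<close> is the second derivative of \<open>x'\<^sup>a\<close> with respect to \<open>x\<^sup>b\<close> and \<open>x\<^sup>s\<close>.\<close>

definition jac :: "('m, 'n::finite) chart \<Rightarrow> ('m, 'n) chart \<Rightarrow> real ^ 'n \<Rightarrow> real ^ 'n ^ 'n" where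
  "jac c c' x = jacobian (transition c c') (at x)"

definition jac2 ::
    "('m, 'n::finite) chart \<Rightarrow> ('m, 'n) chart \<Rightarrow> 'n \<Rightarrow> 'n \<Rightarrow> 'n \<Rightarrow> real ^ 'n \<Rightarrow> real" where
  "jac2 c c' a b s x = frechet_derivative (\<lambda>x. jac c c' x $ a $ s) (at x) (axis b 1)"

text \<open>A tangent vector at \<open>p\<close> is the family of its components in all charts around \<open>p\<close>, subject
  to the contravariant transformation law. The value at charts not containing \<open>p\<close> is normalised
  to zero, so that different tangent vectors are different functions.\<close>

type_synonym ('m, 'n) tvec = "('m, 'n) chart \<Rightarrow> real ^ 'n"

definition tangent_space :: "('m, 'n::finite) chart set \<Rightarrow> 'm \<Rightarrow> ('m, 'n) tvec set" where
  "tangent_space A p =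
     {v. (\<forall>c\<in>A. \<forall>c'\<in>A. p \<in> fst c \<longrightarrow> p \<in> fst c' \<longrightarrow> v c' = jac c c' (snd c p) *v v c) \<and>
         (\<forall>c. \<not> (c \<in> A \<and> p \<in> fst c) \<longrightarrow> v c = 0)}"

definition tangent_bundle ::
    "'m topology \<Rightarrow> ('m, 'n::finite) chart set \<Rightarrow> ('m \<times> ('m, 'n) tvec) set" where
  "tangent_bundle M A = (SIGMA p : topspace M. tangent_space A p)"

definition induced_dom ::
    "'m topology \<Rightarrow> ('m, 'n::finite) chart set \<Rightarrow> ('m, 'n) chart \<Rightarrow> ('m \<times> ('m, 'n) tvec) set" where
  "induced_dom M A c = {u \<in> tangent_bundle M A. fst u \<in> fst c}"

definition induced_coords ::
    "('m, 'n::finite) chart \<Rightarrow> 'm \<times> ('m, 'n) tvec \<Rightarrow> (real ^ 'n) \<times> (real ^ 'n)" where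
  "induced_coords c u = (snd c (fst u), snd u c)"

definition induced_image :: "('m, 'n::finite) chart \<Rightarrow> ((real ^ 'n) \<times> (real ^ 'n)) set" where
  "induced_image c = (snd c ` fst c) \<times> UNIV"


section \<open>Non-linear connections and GAP-spaces\<close>

text \<open>Functions of the induced coordinates \<open>(x, y)\<close>; tensors and connection coefficients take
  their upper index first and then the lower ones from left to right.\<close>

type_synonym 'n tfun = "(real ^ 'n) \<times> (real ^ 'n) \<Rightarrow> real"

definition nonlinear_connection ::
    "'m topology \<Rightarrow> ('m, 'n::finite) chart set \<Rightarrow> (('m, 'n) chart \<Rightarrow> 'n \<Rightarrow> 'n \<Rightarrow> 'n tfun) \<Rightarrow> bool"
where
  "nonlinear_connection M A N \<longleftrightarrow>
     (\<forall>c\<in>A. \<forall>\<alpha> \<beta>. smooth_on (induced_image c) (N c \<alpha> \<beta>)) \<and>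
     (\<forall>c\<in>A. \<forall>c'\<in>A. \<forall>u \<in> induced_dom M A c \<inter> induced_dom M A c'. \<forall>\<alpha>' \<beta>'.
        let x = snd c (fst u); x' = snd c' (fst u); y' = snd u c' in
        N c' \<alpha>' \<beta>' (induced_coords c' u) =
          (\<Sum>\<alpha>\<in>UNIV. \<Sum>\<beta>\<in>UNIV.
             jac c c' x $ \<alpha>' $ \<alpha> * jac c' c x' $ \<beta> $ \<beta>' * N c \<alpha> \<beta> (induced_coords c u)) +
          (\<Sum>\<epsilon>\<in>UNIV. \<Sum>\<sigma>'\<in>UNIV.
             jac c c' x $ \<alpha>' $ \<epsilon> * jac2 c' c \<epsilon> \<beta>' \<sigma>' x' * y' $ \<sigma>'))"

definition section_comp ::
    "'m topology \<Rightarrow> ('m, 'n::finite) chart set \<Rightarrow> ('m, 'n) chart \<Rightarrow>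
     ('m \<times> ('m, 'n) tvec \<Rightarrow> ('m, 'n) tvec) \<Rightarrow> 'n \<Rightarrow> 'n tfun" where
  "section_comp M A c s \<alpha> z = s (inv_into (induced_dom M A c) (induced_coords c) z) c $ \<alpha>"

definition pullback_section ::
    "'m topology \<Rightarrow> ('m, 'n::finite) chart set \<Rightarrow> ('m \<times> ('m, 'n) tvec \<Rightarrow> ('m, 'n) tvec) \<Rightarrow> bool"
where
  "pullback_section M A s \<longleftrightarrow>
     (\<forall>u\<in>tangent_bundle M A. s u \<in> tangent_space A (fst u)) \<and>
     (\<forall>c\<in>A. \<forall>\<alpha>. smooth_on (induced_image c) (section_comp M A c s \<alpha>))"

text \<open>The family \<open>lam\<close> is indexed by \<open>'n\<close>, so there are as many sections as the dimension.\<close>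

definition gap_space ::
    "'m topology \<Rightarrow> ('m, 'n::finite) chart set \<Rightarrow> ('n \<Rightarrow> 'm \<times> ('m, 'n) tvec \<Rightarrow> ('m, 'n) tvec) \<Rightarrow>
     bool" where
  "gap_space M A lam \<longleftrightarrow> smooth_manifold M A \<and> (\<forall>i. pullback_section M A (lam i)) \<and>
     (\<forall>u\<in>tangent_bundle M A. \<forall>a :: 'n \<Rightarrow> real.
        (\<forall>c. (\<Sum>i\<in>UNIV. a i *\<^sub>R lam i u c) = 0) \<longrightarrow> (\<forall>i. a i = 0))"


section \<open>Local differential calculus\<close>

definition dx :: "'n \<Rightarrow> 'n::finite tfun \<Rightarrow> 'n tfun" where
  "dx \<mu> f z = frechet_derivative f (at z) (axis \<mu> 1, 0)"

definition dy :: "'n \<Rightarrow> 'n::finite tfun \<Rightarrow> 'n tfun" where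
  "dy \<mu> f z = frechet_derivative f (at z) (0, axis \<mu> 1)"

definition delta :: "('n \<Rightarrow> 'n \<Rightarrow> 'n::finite tfun) \<Rightarrow> 'n \<Rightarrow> 'n tfun \<Rightarrow> 'n tfun" where
  "delta N \<mu> f z = dx \<mu> f z - (\<Sum>\<alpha>\<in>UNIV. N \<alpha> \<mu> z * dy \<alpha> f z)"

text \<open>In a fixed induced chart a frame \<open>L\<close> has the components \<open>L i \<alpha>\<close>.\<close>

definition coframe :: "('n \<Rightarrow> 'n \<Rightarrow> 'n::finite tfun) \<Rightarrow> 'n \<Rightarrow> 'n \<Rightarrow> 'n tfun" where
  "coframe L i \<mu> z = matrix_inv (\<chi> j \<alpha>. L j \<alpha> z) $ \<mu> $ i"

definition gap_metric :: "('n \<Rightarrow> 'n \<Rightarrow> 'n::finite tfun) \<Rightarrow> 'n \<Rightarrow> 'n \<Rightarrow> 'n tfun" where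
  "gap_metric L \<mu> \<nu> z = (\<Sum>i\<in>UNIV. coframe L i \<mu> z * coframe L i \<nu> z)"

definition inv_gap_metric :: "('n \<Rightarrow> 'n \<Rightarrow> 'n::finite tfun) \<Rightarrow> 'n \<Rightarrow> 'n \<Rightarrow> 'n tfun" where
  "inv_gap_metric L \<mu> \<nu> z = matrix_inv (\<chi> \<alpha> \<beta>. gap_metric L \<alpha> \<beta> z) $ \<mu> $ \<nu>"

record ('n::finite) dconn =
  nlc :: "'n \<Rightarrow> 'n \<Rightarrow> 'n tfun"
  hcoef :: "'n \<Rightarrow> 'n \<Rightarrow> 'n \<Rightarrow> 'n tfun"
  vcoef :: "'n \<Rightarrow> 'n \<Rightarrow> 'n \<Rightarrow> 'n tfun"

definition canonical_dconn ::
    "('n \<Rightarrow> 'n \<Rightarrow> 'n::finite tfun) \<Rightarrow> ('n \<Rightarrow> 'n \<Rightarrow> 'n tfun) \<Rightarrow> 'n dconn" where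
  "canonical_dconn N L =
     \<lparr> nlc = N,
       hcoef = (\<lambda>\<alpha> \<mu> \<nu> z. \<Sum>i\<in>UNIV. L i \<alpha> z * delta N \<nu> (coframe L i \<mu>) z),
       vcoef = (\<lambda>\<alpha> \<mu> \<nu> z. \<Sum>i\<in>UNIV. L i \<alpha> z * dy \<nu> (coframe L i \<mu>) z) \<rparr>"

definition riemannian_dconn ::
    "('n \<Rightarrow> 'n \<Rightarrow> 'n::finite tfun) \<Rightarrow> ('n \<Rightarrow> 'n \<Rightarrow> 'n tfun) \<Rightarrow> 'n dconn" where
  "riemannian_dconn N L =
     \<lparr> nlc = N,
       hcoef = (\<lambda>\<alpha> \<mu> \<nu> z. 1/2 * (\<Sum>\<epsilon>\<in>UNIV. inv_gap_metric L \<alpha> \<epsilon> z *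
         (delta N \<mu> (gap_metric L \<nu> \<epsilon>) z + delta N \<nu> (gap_metric L \<mu> \<epsilon>) z - delta N \<epsilon> (gap_metric L \<mu> \<nu>) z))),
       vcoef = (\<lambda>\<alpha> \<mu> \<nu> z. 1/2 * (\<Sum>\<epsilon>\<in>UNIV. inv_gap_metric L \<alpha> \<epsilon> z *
         (dy \<mu> (gap_metric L \<nu> \<epsilon>) z + dy \<nu> (gap_metric L \<mu> \<epsilon>) z - dy \<epsilon> (gap_metric L \<mu> \<nu>) z))) \<rparr>"

definition dual_dconn :: "'n::finite dconn \<Rightarrow> 'n dconn" where
  "dual_dconn D =
     \<lparr> nlc = nlc D,
       hcoef = (\<lambda>\<alpha> \<mu> \<nu> z. hcoef D \<alpha> \<nu> \<mu> z),
       vcoef = (\<lambda>\<alpha> \<mu> \<nu> z. vcoef D \<alpha> \<nu> \<mu> z) \<rparr>"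

definition symmetric_dconn :: "'n::finite dconn \<Rightarrow> 'n dconn" where
  "symmetric_dconn D =
     \<lparr> nlc = nlc D,
       hcoef = (\<lambda>\<alpha> \<mu> \<nu> z. 1/2 * (hcoef D \<alpha> \<mu> \<nu> z + hcoef D \<alpha> \<nu> \<mu> z)),
       vcoef = (\<lambda>\<alpha> \<mu> \<nu> z. 1/2 * (vcoef D \<alpha> \<mu> \<nu> z + vcoef D \<alpha> \<nu> \<mu> z)) \<rparr>"

text \<open>Covariant derivatives of tensors of type (0,1) and (0,2). The index of the derivative is the
  last one: \<open>hcov1 D X \<mu> \<nu>\<close> is \<open>X\<close> with index \<open>\<mu>\<close>, differentiated in the direction \<open>\<nu>\<close>.\<close>

definition hcov1 :: "'n::finite dconn \<Rightarrow> ('n \<Rightarrow> 'n tfun) \<Rightarrow> 'n \<Rightarrow> 'n \<Rightarrow> 'n tfun" where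
  "hcov1 D X \<mu> \<nu> z = delta (nlc D) \<nu> (X \<mu>) z - (\<Sum>\<epsilon>\<in>UNIV. X \<epsilon> z * hcoef D \<epsilon> \<mu> \<nu> z)"

definition hcov2 :: "'n::finite dconn \<Rightarrow> ('n \<Rightarrow> 'n \<Rightarrow> 'n tfun) \<Rightarrow> 'n \<Rightarrow> 'n \<Rightarrow> 'n \<Rightarrow> 'n tfun" where
  "hcov2 D X \<mu> \<nu> \<sigma> z = delta (nlc D) \<sigma> (X \<mu> \<nu>) z
     - (\<Sum>\<epsilon>\<in>UNIV. X \<epsilon> \<nu> z * hcoef D \<epsilon> \<mu> \<sigma> z) - (\<Sum>\<epsilon>\<in>UNIV. X \<mu> \<epsilon> z * hcoef D \<epsilon> \<nu> \<sigma> z)"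

definition vcov1 :: "'n::finite dconn \<Rightarrow> ('n \<Rightarrow> 'n tfun) \<Rightarrow> 'n \<Rightarrow> 'n \<Rightarrow> 'n tfun" where
  "vcov1 D X \<mu> \<nu> z = dy \<nu> (X \<mu>) z - (\<Sum>\<epsilon>\<in>UNIV. X \<epsilon> z * vcoef D \<epsilon> \<mu> \<nu> z)"

definition vcov2 :: "'n::finite dconn \<Rightarrow> ('n \<Rightarrow> 'n \<Rightarrow> 'n tfun) \<Rightarrow> 'n \<Rightarrow> 'n \<Rightarrow> 'n \<Rightarrow> 'n tfun" where
  "vcov2 D X \<mu> \<nu> \<sigma> z = dy \<sigma> (X \<mu> \<nu>) z
     - (\<Sum>\<epsilon>\<in>UNIV. X \<epsilon> \<nu> z * vcoef D \<epsilon> \<mu> \<sigma> z) - (\<Sum>\<epsilon>\<in>UNIV. X \<mu> \<epsilon> z * vcoef D \<epsilon> \<nu> \<sigma> z)"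

text \<open>The W-tensors are specified implicitly. At every point where \<open>L\<close> is invertible the
  system has exactly one solution, so the descriptions are proper there. The order of the indices
  of \<open>H\<close> is upper index, then the three lower indices.\<close>

definition hW :: "'n::finite dconn \<Rightarrow> ('n \<Rightarrow> 'n \<Rightarrow> 'n tfun) \<Rightarrow> 'n \<Rightarrow> 'n \<Rightarrow> 'n \<Rightarrow> 'n \<Rightarrow> 'n tfun" where
  "hW D L \<alpha> \<mu> \<nu> \<sigma> z =
     (THE H :: 'n \<Rightarrow> 'n \<Rightarrow> 'n \<Rightarrow> 'n \<Rightarrow> real. \<forall>i \<mu> \<nu> \<sigma>.
        hcov2 D (hcov1 D (coframe L i)) \<mu> \<nu> \<sigma> z - hcov2 D (hcov1 D (coframe L i)) \<mu> \<sigma> \<nu> z =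
        (\<Sum>\<epsilon>\<in>UNIV. coframe L i \<epsilon> z * H \<epsilon> \<mu> \<nu> \<sigma>)) \<alpha> \<mu> \<nu> \<sigma>"

definition vW :: "'n::finite dconn \<Rightarrow> ('n \<Rightarrow> 'n \<Rightarrow> 'n tfun) \<Rightarrow> 'n \<Rightarrow> 'n \<Rightarrow> 'n \<Rightarrow> 'n \<Rightarrow> 'n tfun" where
  "vW D L \<alpha> \<mu> \<nu> \<sigma> z =
     (THE V :: 'n \<Rightarrow> 'n \<Rightarrow> 'n \<Rightarrow> 'n \<Rightarrow> real. \<forall>i \<mu> \<nu> \<sigma>.
        vcov2 D (vcov1 D (coframe L i)) \<mu> \<nu> \<sigma> z - vcov2 D (vcov1 D (coframe L i)) \<mu> \<sigma> \<nu> z =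
        (\<Sum>\<epsilon>\<in>UNIV. coframe L i \<epsilon> z * V \<epsilon> \<mu> \<nu> \<sigma>)) \<alpha> \<mu> \<nu> \<sigma>"

definition W_trace :: "('n::finite \<Rightarrow> 'n \<Rightarrow> 'n \<Rightarrow> 'n \<Rightarrow> 'n tfun) \<Rightarrow> 'n \<Rightarrow> 'n \<Rightarrow> 'n tfun" where
  "W_trace H \<nu> \<sigma> z = (\<Sum>\<alpha>\<in>UNIV. H \<alpha> \<alpha> \<nu> \<sigma> z)"

definition htorsion :: "'n::finite dconn \<Rightarrow> 'n \<Rightarrow> 'n \<Rightarrow> 'n \<Rightarrow> 'n tfun" where
  "htorsion D \<alpha> \<mu> \<nu> z = hcoef D \<alpha> \<mu> \<nu> z - hcoef D \<alpha> \<nu> \<mu> z"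

definition vtorsion :: "'n::finite dconn \<Rightarrow> 'n \<Rightarrow> 'n \<Rightarrow> 'n \<Rightarrow> 'n tfun" where
  "vtorsion D \<alpha> \<mu> \<nu> z = vcoef D \<alpha> \<mu> \<nu> z - vcoef D \<alpha> \<nu> \<mu> z"

text \<open>Contraction of the upper index with the second lower index.\<close>

definition torsion_trace :: "('n::finite \<Rightarrow> 'n \<Rightarrow> 'n \<Rightarrow> 'n tfun) \<Rightarrow> 'n \<Rightarrow> 'n tfun" where
  "torsion_trace T \<mu> z = (\<Sum>\<epsilon>\<in>UNIV. T \<epsilon> \<mu> \<epsilon> z)"

end

theory Submission
  imports Defs
begin

text \<open>In an induced chart let \<open>d\<close> be either the family \<open>\<delta>\<^sub>\<nu>\<close> or the family of vertical
  derivatives, and let \<open>\<Gamma>\<close> be the corresponding canonical coefficients. For an arbitrary connection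
  with coefficients \<open>G\<close>, put \<open>b\<^sub>\<nu> = G\<^sup>\<alpha>\<^sub>\<alpha>\<^sub>\<nu> - \<Gamma>\<^sup>\<alpha>\<^sub>\<alpha>\<^sub>\<nu>\<close>. The trace of its W-tensor is
  \<open>d\<^sub>\<nu> b\<^sub>\<sigma> - d\<^sub>\<sigma> b\<^sub>\<nu> + b\<^sub>\<epsilon> (G\<^sup>\<epsilon>\<^sub>\<nu>\<^sub>\<sigma> - G\<^sup>\<epsilon>\<^sub>\<sigma>\<^sub>\<nu>)\<close>,
  because in the Ricci identity for the coframe the terms quadratic in \<open>G\<close> have no trace, and the
  contribution of the commutator of \<open>d\<^sub>\<nu>\<close> and \<open>d\<^sub>\<sigma>\<close> is the curl of \<open>\<Gamma>\<^sup>\<alpha>\<^sub>\<alpha>\<^sub>\<nu>\<close>. It remains to read off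
  \<open>b\<close>: it is \<open>\<beta>\<close> (or \<open>B\<close>) for the dual connection and \<open>\<beta>/2\<close> for the symmetric one, and it vanishes for
  the Riemannian one; the last two connections are moreover symmetric.\<close>

section \<open>Directional derivatives\<close>

lemma
  fixes A :: "'a::semiring_1^'n^'m"
  assumes "invertible A"
  shows matrix_inv_right: "A ** matrix_inv A = mat 1"
    and matrix_inv_left: "matrix_inv A ** A = mat 1"
proof -
  have "A ** matrix_inv A = mat 1 \<and> matrix_inv A ** A = mat 1"
    using assms unfolding invertible_def matrix_inv_def by (rule someI_ex)
  then show "A ** matrix_inv A = mat 1" "matrix_inv A ** A = mat 1" by simp_all
qed

lemma matrix_inv_eqI:
  fixes A B :: "'a::field^'n^'n"
  assumes "A ** B = mat 1"
  shows "matrix_inv A = B"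
proof -
  have "B ** A = mat 1" using assms matrix_left_right_inverse by blast
  then have "invertible A" using assms unfolding invertible_def by blast
  then have "matrix_inv A ** A = mat 1" by (rule matrix_inv_left)
  then have "matrix_inv A ** (A ** B) = B" by (metis matrix_mul_assoc matrix_mul_lid)
  then show ?thesis using assms by simp
qed

lemma differentiable_prod:
  fixes f :: "'i \<Rightarrow> 'a::real_normed_vector \<Rightarrow> real"
  assumes "\<And>i. i \<in> I \<Longrightarrow> f i differentiable (at x)"
  shows "(\<lambda>x. \<Prod>i\<in>I. f i x) differentiable (at x)"
proof -
  have "\<And>i. i \<in> I \<Longrightarrow> (f i has_derivative frechet_derivative (f i) (at x)) (at x)"
    using assms frechet_derivative_works by blast
  from has_derivative_prod[OF this] show ?thesis by (rule differentiableI)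
qed

lemma differentiable_det:
  fixes F :: "'n::finite \<Rightarrow> 'n \<Rightarrow> 'a::real_normed_vector \<Rightarrow> real"
  assumes "\<And>i j. F i j differentiable (at x)"
  shows "(\<lambda>x. det (\<chi> i j. F i j x)) differentiable (at x)"
  unfolding det_def using assms
  by (auto intro!: differentiable_sum differentiable_mult differentiable_prod)

lemma differentiable_transform_open:
  assumes "f differentiable (at x)" "open U" "x \<in> U" "\<And>y. y \<in> U \<Longrightarrow> f y = g y"
  shows "g differentiable (at x)"
  using assms by (meson differentiable_def has_derivative_transform_within_open)

text \<open>By Cramer's rule an entry of the inverse is a quotient of two determinants, hence of
  polynomials in the entries. The rule requires invertibility, so differentiability of the quotient
  is carried over along the open set \<open>U\<close>.\<close>

lemma differentiable_matrix_inv: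
  fixes F :: "'n::finite \<Rightarrow> 'n \<Rightarrow> 'a::real_normed_vector \<Rightarrow> real"
  assumes "open U" "x \<in> U" "\<And>i j. F i j differentiable (at x)"
    and inv: "\<And>x. x \<in> U \<Longrightarrow> invertible (\<chi> i j. F i j x)"
  shows "(\<lambda>x. matrix_inv (\<chi> i j. F i j x) $ a $ b) differentiable (at x)"
proof -
  \<comment> \<open>Column \<open>a\<close> is replaced by the unit vector with index
    \<open>b\<close>; its determinant is the numerator in Cramer's rule.\<close>
  define C where "C i j = (if j = a then \<lambda>_. axis b 1 $ i else F i j)" for i j
  have cramer_inv: "det (\<chi> i j. C i j y) / det (\<chi> i j. F i j y) = matrix_inv (\<chi> i j. F i j y) $ a $ b"
    if "y \<in> U" for y
  proof -
    let ?A = "\<chi> i j. F i j y"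
    have "det ?A \<noteq> 0" using inv[OF that] invertible_det_nz by blast
    moreover have "?A *v (matrix_inv ?A *v axis b 1) = axis b 1"
      using inv[OF that] by (simp add: matrix_vector_mul_assoc matrix_inv_right)
    ultimately have "matrix_inv ?A *v axis b 1
        = (\<chi> k. det (\<chi> i j. if j = k then axis b 1 $ i else ?A $ i $ j) / det ?A)"
      using cramer by blast
    then have "(matrix_inv ?A *v axis b 1) $ a
        = det (\<chi> i j. if j = a then axis b 1 $ i else ?A $ i $ j) / det ?A"
      by simp
    moreover have "(\<chi> i j. if j = a then axis b 1 $ i else ?A $ i $ j) = (\<chi> i j. C i j y)"
      by (auto simp: C_def vec_eq_iff)
    ultimately show ?thesis by (simp add: matrix_vector_mul_component inner_axis)
  qed
  have "C i j differentiable (at x)" for i j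
    using assms(3) by (simp add: C_def)
  then have "(\<lambda>y. det (\<chi> i j. C i j y) / det (\<chi> i j. F i j y)) differentiable (at x)"
    using assms invertible_det_nz[of "\<chi> i j. F i j x"] inv[OF \<open>x \<in> U\<close>]
    by (intro differentiable_divide differentiable_det) auto
  then show ?thesis
    by (rule differentiable_transform_open[OF _ \<open>open U\<close> \<open>x \<in> U\<close>]) (rule cramer_inv)
qed

text \<open>The direction \<open>w \<nu> z\<close> may vary with the point, as it does for
  \<open>delta N\<close> through \<open>N\<close>, and the operators are not assumed to commute; so
  horizontal and vertical derivatives are treated alike. The value of \<open>d\<close> at a
  non-differentiable function is left open, hence the differentiability premises below.\<close>

locale directional_derivative =
  fixes d :: "'i \<Rightarrow> ('e::real_normed_vector \<Rightarrow> real) \<Rightarrow> 'e \<Rightarrow> real" and w :: "'i \<Rightarrow> 'e \<Rightarrow> 'e"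
  assumes d_frechet:
    "f differentiable (at z) \<Longrightarrow> d \<nu> f z = frechet_derivative f (at z) (w \<nu> z)"
begin

lemma d_eqI: "(f has_derivative f') (at z) \<Longrightarrow> d \<nu> f z = f' (w \<nu> z)"
  by (metis d_frechet differentiableI frechet_derivative_at)

lemma d_diff:
  assumes "f differentiable (at z)" "g differentiable (at z)"
  shows "d \<nu> (\<lambda>z. f z - g z) z = d \<nu> f z - d \<nu> g z"
  using assms by (subst d_eqI[OF has_derivative_diff]) (auto simp: frechet_derivative_works d_frechet)

lemma d_mult:
  assumes "f differentiable (at z)" "g differentiable (at z)"
  shows "d \<nu> (\<lambda>z. f z * g z) z = d \<nu> f z * g z + f z * d \<nu> g z"
  using assms by (subst d_eqI[OF has_derivative_mult]) (auto simp: frechet_derivative_works d_frechet)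

lemma d_const [simp]: "d \<nu> (\<lambda>_. k) z = 0"
  by (subst d_eqI[OF has_derivative_const]) simp

lemma d_cmult: "f differentiable (at z) \<Longrightarrow> d \<nu> (\<lambda>z. k * f z) z = k * d \<nu> f z"
  by (simp add: d_mult)

lemma d_sum:
  assumes "\<And>i. i \<in> I \<Longrightarrow> f i differentiable (at z)"
  shows "d \<nu> (\<lambda>z. \<Sum>i\<in>I. f i z) z = (\<Sum>i\<in>I. d \<nu> (f i) z)"
  using assms by (subst d_eqI[OF has_derivative_sum]) (auto simp: frechet_derivative_works d_frechet)

lemma d_sum_mult:
  fixes X Y :: "'j::finite \<Rightarrow> 'e \<Rightarrow> real"
  assumes "\<And>\<epsilon>. X \<epsilon> differentiable (at z)" "\<And>\<epsilon>. Y \<epsilon> differentiable (at z)"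
  shows "d \<sigma> (\<lambda>z. \<Sum>\<epsilon>\<in>UNIV. X \<epsilon> z * Y \<epsilon> z) z
    = (\<Sum>\<epsilon>\<in>UNIV. d \<sigma> (X \<epsilon>) z * Y \<epsilon> z + X \<epsilon> z * d \<sigma> (Y \<epsilon>) z)"
  using assms by (simp add: d_sum d_mult differentiable_mult)

lemma d_cong:
  assumes "open U" "z \<in> U" "f differentiable (at z)" "\<And>y. y \<in> U \<Longrightarrow> f y = g y"
  shows "d \<nu> f z = d \<nu> g z"
  using assms differentiable_transform_open[OF assms(3,1,2,4)]
  by (simp add: d_frechet frechet_derivative_transform_within_open[OF assms(3,1,2,4)])

end

section \<open>The trace of the W-tensor\<close>

text \<open>One formula for both kinds of derivative: \<open>delta (nlc D)\<close> with
  \<open>hcoef D\<close> gives \<open>hcov1\<close>, and \<open>dy\<close> with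
  \<open>vcoef D\<close> gives \<open>vcov1\<close>. The same holds for \<open>cov2\<close>.\<close>

definition cov1 ::
    "('n \<Rightarrow> 'n tfun \<Rightarrow> 'n tfun) \<Rightarrow> ('n \<Rightarrow> 'n \<Rightarrow> 'n \<Rightarrow> 'n tfun) \<Rightarrow> ('n::finite \<Rightarrow> 'n tfun) \<Rightarrow>
     'n \<Rightarrow> 'n \<Rightarrow> 'n tfun" where
  "cov1 d G X \<mu> \<nu> z = d \<nu> (X \<mu>) z - (\<Sum>\<epsilon>\<in>UNIV. X \<epsilon> z * G \<epsilon> \<mu> \<nu> z)"

definition cov2 ::
    "('n \<Rightarrow> 'n tfun \<Rightarrow> 'n tfun) \<Rightarrow> ('n \<Rightarrow> 'n \<Rightarrow> 'n \<Rightarrow> 'n tfun) \<Rightarrow> ('n::finite \<Rightarrow> 'n \<Rightarrow> 'n tfun) \<Rightarrow>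
     'n \<Rightarrow> 'n \<Rightarrow> 'n \<Rightarrow> 'n tfun" where
  "cov2 d G X \<mu> \<nu> \<sigma> z = d \<sigma> (X \<mu> \<nu>) z
     - (\<Sum>\<epsilon>\<in>UNIV. X \<epsilon> \<nu> z * G \<epsilon> \<mu> \<sigma> z) - (\<Sum>\<epsilon>\<in>UNIV. X \<mu> \<epsilon> z * G \<epsilon> \<nu> \<sigma> z)"

definition cov_comm ::
    "('n \<Rightarrow> 'n tfun \<Rightarrow> 'n tfun) \<Rightarrow> ('n \<Rightarrow> 'n \<Rightarrow> 'n \<Rightarrow> 'n tfun) \<Rightarrow> ('n::finite \<Rightarrow> 'n tfun) \<Rightarrow>
     'n \<Rightarrow> 'n \<Rightarrow> 'n \<Rightarrow> 'n tfun" where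
  "cov_comm d G X \<mu> \<nu> \<sigma> z = cov2 d G (cov1 d G X) \<mu> \<nu> \<sigma> z - cov2 d G (cov1 d G X) \<mu> \<sigma> \<nu> z"

lemma d_cov1:
  fixes d :: "'n::finite \<Rightarrow> 'n tfun \<Rightarrow> 'n tfun"
  assumes "directional_derivative d w"
    and "\<And>\<mu>. X \<mu> differentiable (at z)" "\<And>\<mu> \<nu>. d \<nu> (X \<mu>) differentiable (at z)"
    and "\<And>\<alpha> \<mu> \<nu>. G \<alpha> \<mu> \<nu> differentiable (at z)"
  shows "d \<sigma> (cov1 d G X \<mu> \<nu>) z = d \<sigma> (d \<nu> (X \<mu>)) z
    - (\<Sum>\<epsilon>\<in>UNIV. d \<sigma> (X \<epsilon>) z * G \<epsilon> \<mu> \<nu> z + X \<epsilon> z * d \<sigma> (G \<epsilon> \<mu> \<nu>) z)"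
proof -
  interpret directional_derivative d w by fact
  have "cov1 d G X \<mu> \<nu> = (\<lambda>z. d \<nu> (X \<mu>) z - (\<Sum>\<epsilon>\<in>UNIV. X \<epsilon> z * G \<epsilon> \<mu> \<nu> z))"
    by (simp add: cov1_def fun_eq_iff)
  then show ?thesis
    using assms(2-) by (simp add: d_diff d_sum_mult differentiable_sum differentiable_mult)
qed

text \<open>The products of a first derivative of \<open>X\<close> with \<open>G\<close> are
  symmetric in \<nu> and \<sigma> and cancel. What survives is the commutator of the derivations,
  the curvature expression of \<open>G\<close>, and a torsion term caused by transporting the
  derivative index.\<close>

lemma ricci_identity:
  fixes d :: "'n::finite \<Rightarrow> 'n tfun \<Rightarrow> 'n tfun"
  assumes "directional_derivative d w"
    and "\<And>\<mu>. X \<mu> differentiable (at z)" "\<And>\<mu> \<nu>. d \<nu> (X \<mu>) differentiable (at z)"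
    and "\<And>\<alpha> \<mu> \<nu>. G \<alpha> \<mu> \<nu> differentiable (at z)"
  shows "cov_comm d G X \<mu> \<nu> \<sigma> z =
      (d \<sigma> (d \<nu> (X \<mu>)) z - d \<nu> (d \<sigma> (X \<mu>)) z)
    + (\<Sum>\<epsilon>\<in>UNIV. X \<epsilon> z * (d \<nu> (G \<epsilon> \<mu> \<sigma>) z - d \<sigma> (G \<epsilon> \<mu> \<nu>) z
        + (\<Sum>\<eta>\<in>UNIV. G \<epsilon> \<eta> \<nu> z * G \<eta> \<mu> \<sigma> z - G \<epsilon> \<eta> \<sigma> z * G \<eta> \<mu> \<nu> z)))
    - (\<Sum>\<epsilon>\<in>UNIV. cov1 d G X \<mu> \<epsilon> z * (G \<epsilon> \<nu> \<sigma> z - G \<epsilon> \<sigma> \<nu> z))"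
proof -
  \<comment> \<open>Transporting the index \<mu> produces the products of two coefficients that
    enter the curvature.\<close>
  have quad: "(\<Sum>\<epsilon>\<in>UNIV. cov1 d G X \<epsilon> \<nu> z * G \<epsilon> \<mu> \<sigma> z) = (\<Sum>\<epsilon>\<in>UNIV. d \<nu> (X \<epsilon>) z * G \<epsilon> \<mu> \<sigma> z)
      - (\<Sum>\<epsilon>\<in>UNIV. X \<epsilon> z * (\<Sum>\<eta>\<in>UNIV. G \<epsilon> \<eta> \<nu> z * G \<eta> \<mu> \<sigma> z))" for \<nu> \<sigma>
  proof -
    have "(\<Sum>\<epsilon>\<in>UNIV. (\<Sum>\<eta>\<in>UNIV. X \<eta> z * G \<eta> \<epsilon> \<nu> z) * G \<epsilon> \<mu> \<sigma> z)
        = (\<Sum>\<epsilon>\<in>UNIV. X \<epsilon> z * (\<Sum>\<eta>\<in>UNIV. G \<epsilon> \<eta> \<nu> z * G \<eta> \<mu> \<sigma> z))"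
      unfolding sum_distrib_left sum_distrib_right by (subst sum.swap) (simp add: mult.assoc)
    then show ?thesis by (simp add: cov1_def left_diff_distrib sum_subtractf)
  qed
  show ?thesis
    unfolding cov_comm_def cov2_def d_cov1[OF assms] quad
    by (simp add: sum.distrib sum_subtractf right_diff_distrib distrib_left)
qed

text \<open>Second covariant derivatives of the coframe call for two orders of differentiability.
  The second is a separate assumption because for \<open>delta N\<close> it also involves the
  regularity of \<open>N\<close>.\<close>

locale frame_calculus = directional_derivative d w
  for d :: "'n::finite \<Rightarrow> 'n tfun \<Rightarrow> 'n tfun"
    and w :: "'n \<Rightarrow> (real ^ 'n) \<times> (real ^ 'n) \<Rightarrow> (real ^ 'n) \<times> (real ^ 'n)" +
  fixes L :: "'n \<Rightarrow> 'n \<Rightarrow> 'n tfun" and U :: "((real ^ 'n) \<times> (real ^ 'n)) set"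
  assumes open_U: "open U"
    and frame_inv: "z \<in> U \<Longrightarrow> invertible (\<chi> j \<alpha>. L j \<alpha> z)"
    and frame_diff: "z \<in> U \<Longrightarrow> L i \<alpha> differentiable (at z)"
    and d_frame_diff: "z \<in> U \<Longrightarrow> d \<nu> (L i \<alpha>) differentiable (at z)"
begin

abbreviation "lam \<equiv> coframe L"

text \<open>The canonical coefficients belonging to \<open>d\<close>, that is \<Gamma> or C. On
  \<open>U\<close> they are the coefficients for which every coframe element is parallel.\<close>

definition gam :: "'n \<Rightarrow> 'n \<Rightarrow> 'n \<Rightarrow> 'n tfun" where
  "gam \<alpha> \<mu> \<nu> z = (\<Sum>i\<in>UNIV. L i \<alpha> z * d \<nu> (lam i \<mu>) z)"

section \<open>Duality of frame and coframe, and the explicit W-tensor\<close>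

lemma frame_coframe:
  assumes "z \<in> U"
  shows "(\<Sum>\<alpha>\<in>UNIV. L j \<alpha> z * lam i \<alpha> z) = (if j = i then 1 else 0)"
proof -
  have "(\<chi> j \<alpha>. L j \<alpha> z) ** matrix_inv (\<chi> j \<alpha>. L j \<alpha> z) = mat 1"
    using frame_inv[OF assms] by (rule matrix_inv_right)
  then have "((\<chi> j \<alpha>. L j \<alpha> z) ** matrix_inv (\<chi> j \<alpha>. L j \<alpha> z)) $ j $ i = mat 1 $ j $ i" by simp
  then show ?thesis by (simp add: matrix_matrix_mult_def mat_def coframe_def)
qed

lemma coframe_frame:
  assumes "z \<in> U"
  shows "(\<Sum>i\<in>UNIV. L i \<alpha> z * lam i \<beta> z) = (if \<alpha> = \<beta> then 1 else 0)"
proof -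
  have "matrix_inv (\<chi> j \<alpha>. L j \<alpha> z) ** (\<chi> j \<alpha>. L j \<alpha> z) = mat 1"
    using frame_inv[OF assms] by (rule matrix_inv_left)
  then have "(matrix_inv (\<chi> j \<alpha>. L j \<alpha> z) ** (\<chi> j \<alpha>. L j \<alpha> z)) $ \<beta> $ \<alpha> = mat 1 $ \<beta> $ \<alpha>" by simp
  then show ?thesis by (auto simp: matrix_matrix_mult_def mat_def coframe_def mult.commute)
qed

lemma contract_coframe:
  assumes "z \<in> U"
  shows "(\<Sum>i\<in>UNIV. L i \<alpha> z * (\<Sum>\<epsilon>\<in>UNIV. lam i \<epsilon> z * Y \<epsilon>)) = Y \<alpha>"
proof -
  have "(\<Sum>i\<in>UNIV. L i \<alpha> z * (\<Sum>\<epsilon>\<in>UNIV. lam i \<epsilon> z * Y \<epsilon>))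
      = (\<Sum>\<epsilon>\<in>UNIV. (\<Sum>i\<in>UNIV. L i \<alpha> z * lam i \<epsilon> z) * Y \<epsilon>)"
    unfolding sum_distrib_left sum_distrib_right by (subst sum.swap) (simp add: mult.assoc)
  also have "\<dots> = (\<Sum>\<epsilon>\<in>UNIV. if \<alpha> = \<epsilon> then Y \<epsilon> else 0)"
    unfolding coframe_frame[OF assms] by (intro sum.cong) auto
  finally show ?thesis by simp
qed

lemma contract_frame:
  assumes "z \<in> U"
  shows "(\<Sum>\<epsilon>\<in>UNIV. lam i \<epsilon> z * (\<Sum>j\<in>UNIV. L j \<epsilon> z * Y j)) = Y i"
proof -
  have "(\<Sum>\<epsilon>\<in>UNIV. lam i \<epsilon> z * (\<Sum>j\<in>UNIV. L j \<epsilon> z * Y j))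
      = (\<Sum>j\<in>UNIV. (\<Sum>\<epsilon>\<in>UNIV. L j \<epsilon> z * lam i \<epsilon> z) * Y j)"
    unfolding sum_distrib_left sum_distrib_right by (subst sum.swap) (simp add: ac_simps)
  also have "\<dots> = (\<Sum>j\<in>UNIV. if j = i then Y j else 0)"
    unfolding frame_coframe[OF assms] by (intro sum.cong) auto
  finally show ?thesis by simp
qed

text \<open>Contraction with \<open>L\<close> is inverse to contraction with \<open>lam\<close>, so
  the implicit system in \<open>hW\<close> and \<open>vW\<close> has exactly one solution, obtained
  by contracting its left-hand side with the frame.\<close>

lemma W_tensor_eq:
  assumes "z \<in> U"
  shows "(THE H. \<forall>i \<mu> \<nu> \<sigma>. F i \<mu> \<nu> \<sigma> = (\<Sum>\<epsilon>\<in>UNIV. lam i \<epsilon> z * H \<epsilon> \<mu> \<nu> \<sigma>))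
    = (\<lambda>\<alpha> \<mu> \<nu> \<sigma>. \<Sum>i\<in>UNIV. L i \<alpha> z * F i \<mu> \<nu> \<sigma>)"
proof (rule the_equality)
  show "\<forall>i \<mu> \<nu> \<sigma>. F i \<mu> \<nu> \<sigma> = (\<Sum>\<epsilon>\<in>UNIV. lam i \<epsilon> z * (\<Sum>j\<in>UNIV. L j \<epsilon> z * F j \<mu> \<nu> \<sigma>))"
    by (simp add: contract_frame[OF assms])
next
  fix H assume "\<forall>i \<mu> \<nu> \<sigma>. F i \<mu> \<nu> \<sigma> = (\<Sum>\<epsilon>\<in>UNIV. lam i \<epsilon> z * H \<epsilon> \<mu> \<nu> \<sigma>)"
  then show "H = (\<lambda>\<alpha> \<mu> \<nu> \<sigma>. \<Sum>i\<in>UNIV. L i \<alpha> z * F i \<mu> \<nu> \<sigma>)"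
    by (simp add: contract_coframe[OF assms])
qed

lemma coframe_diff: "z \<in> U \<Longrightarrow> lam i \<mu> differentiable (at z)"
  using differentiable_matrix_inv[OF open_U _ frame_diff frame_inv, where a = \<mu> and b = i]
  by (simp add: coframe_def[abs_def])

text \<open>Leibniz rule applied to the duality relation, whose right-hand side is constant.\<close>

lemma d_duality:
  assumes "z \<in> U"
  shows "(\<Sum>i\<in>UNIV. d \<sigma> (L i \<alpha>) z * lam i \<beta> z) = - gam \<alpha> \<beta> \<sigma> z"
proof -
  \<comment> \<open>Duality is available only on \<open>U\<close>, so the two functions are compared
    on that open neighbourhood of \<open>z\<close>.\<close>
  have "d \<sigma> (\<lambda>z. \<Sum>i\<in>UNIV. L i \<alpha> z * lam i \<beta> z) z = d \<sigma> (\<lambda>z. if \<alpha> = \<beta> then 1 else 0) z"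
    by (rule d_cong[OF open_U assms])
      (auto intro!: differentiable_sum differentiable_mult frame_diff coframe_diff assms
        simp: coframe_frame simp del: if_split)
  then show ?thesis
    using assms by (simp add: d_sum_mult frame_diff coframe_diff sum.distrib gam_def)
qed

lemma d_frame_eq:
  assumes "z \<in> U"
  shows "d \<sigma> (L i \<alpha>) z = - (\<Sum>\<beta>\<in>UNIV. gam \<alpha> \<beta> \<sigma> z * L i \<beta> z)"
proof -
  have "(\<Sum>\<beta>\<in>UNIV. L i \<beta> z * (\<Sum>j\<in>UNIV. lam j \<beta> z * d \<sigma> (L j \<alpha>) z)) = d \<sigma> (L i \<alpha>) z"
  proof -
    have "(\<Sum>\<beta>\<in>UNIV. L i \<beta> z * (\<Sum>j\<in>UNIV. lam j \<beta> z * d \<sigma> (L j \<alpha>) z))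
      = (\<Sum>j\<in>UNIV. (\<Sum>\<beta>\<in>UNIV. L i \<beta> z * lam j \<beta> z) * d \<sigma> (L j \<alpha>) z)"
      unfolding sum_distrib_left sum_distrib_right by (subst sum.swap) (simp add: ac_simps)
    also have "\<dots> = (\<Sum>j\<in>UNIV. if i = j then d \<sigma> (L j \<alpha>) z else 0)"
      unfolding frame_coframe[OF assms] by (intro sum.cong) auto
    finally show ?thesis by simp
  qed
  moreover have "(\<Sum>j\<in>UNIV. lam j \<beta> z * d \<sigma> (L j \<alpha>) z) = - gam \<alpha> \<beta> \<sigma> z" for \<beta>
    using d_duality[OF assms, of \<sigma> \<alpha> \<beta>] by (simp add: mult.commute)
  ultimately show ?thesis by (simp add: sum_negf mult.commute)
qed

text \<open>The rule for differentiating an inverse matrix. It expresses derivatives of the coframe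
  through those of the frame, whose differentiability is assumed, and thereby yields
  \<open>d_coframe_diff\<close>.\<close>

lemma d_coframe_eq:
  assumes "z \<in> U"
  shows "d \<nu> (lam i \<beta>) z
    = - (\<Sum>\<alpha>\<in>UNIV. lam i \<alpha> z * (\<Sum>j\<in>UNIV. d \<nu> (L j \<alpha>) z * lam j \<beta> z))"
  using contract_frame[OF assms, of i "\<lambda>j. d \<nu> (lam j \<beta>) z"]
  unfolding d_duality[OF assms] gam_def by (simp add: sum_negf)

lemma d_coframe_diff:
  assumes "z \<in> U"
  shows "d \<nu> (lam i \<beta>) differentiable (at z)"
  by (rule differentiable_transform_open[OF _ open_U assms d_coframe_eq[symmetric]])
    (auto intro!: differentiable_minus differentiable_sum differentiable_mult assms
      coframe_diff d_frame_diff)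

lemma gam_diff: "z \<in> U \<Longrightarrow> gam \<alpha> \<mu> \<nu> differentiable (at z)"
  unfolding gam_def[abs_def]
  by (auto intro!: differentiable_sum differentiable_mult frame_diff d_coframe_diff)

text \<open>The trace of \<open>gam\<close> is the derivative of the logarithm of the determinant of the coframe.
  The first order terms cancel by symmetry, so its curl only sees the commutators of the
  \<open>d \<nu>\<close>, which do not vanish for the operators \<open>delta\<close>.\<close>

lemma curl_gam_trace:
  assumes "z \<in> U"
  shows "(\<Sum>\<alpha>\<in>UNIV. d \<sigma> (gam \<alpha> \<alpha> \<nu>) z) - (\<Sum>\<alpha>\<in>UNIV. d \<nu> (gam \<alpha> \<alpha> \<sigma>) z)
    = (\<Sum>\<alpha>\<in>UNIV. \<Sum>i\<in>UNIV. L i \<alpha> z * (d \<sigma> (d \<nu> (lam i \<alpha>)) z - d \<nu> (d \<sigma> (lam i \<alpha>)) z))"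
proof -
  have dg: "d \<sigma> (gam \<alpha> \<alpha> \<nu>) z = - (\<Sum>\<beta>\<in>UNIV. gam \<alpha> \<beta> \<sigma> z * gam \<beta> \<alpha> \<nu> z)
      + (\<Sum>i\<in>UNIV. L i \<alpha> z * d \<sigma> (d \<nu> (lam i \<alpha>)) z)" for \<sigma> \<nu> \<alpha>
  proof -
    have "d \<sigma> (gam \<alpha> \<alpha> \<nu>) z = (\<Sum>i\<in>UNIV. d \<sigma> (L i \<alpha>) z * d \<nu> (lam i \<alpha>) z)
      + (\<Sum>i\<in>UNIV. L i \<alpha> z * d \<sigma> (d \<nu> (lam i \<alpha>)) z)"
      unfolding gam_def[abs_def] using assms
      by (simp add: d_sum_mult frame_diff d_coframe_diff sum.distrib)
    \<comment> \<open>After \<open>d_frame_eq\<close> the remaining contraction of \<open>L\<close>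
      with a derivative of \<open>lam\<close> is again \<open>gam\<close>. Summed over \<alpha>, the
      result is the trace of a product of two matrices, symmetric in \<nu> and \<sigma>.\<close>
    moreover have "(\<Sum>i\<in>UNIV. d \<sigma> (L i \<alpha>) z * d \<nu> (lam i \<alpha>) z)
      = - (\<Sum>\<beta>\<in>UNIV. gam \<alpha> \<beta> \<sigma> z * gam \<beta> \<alpha> \<nu> z)"
      unfolding d_frame_eq[OF assms] gam_def[of _ \<alpha> \<nu>] sum_distrib_left sum_distrib_right
        sum_negf[symmetric] mult_minus_left
      by (subst sum.swap) (simp add: ac_simps)
    ultimately show ?thesis by simp
  qed
  have "(\<Sum>\<alpha>\<in>UNIV. \<Sum>\<beta>\<in>UNIV. gam \<alpha> \<beta> \<sigma> z * gam \<beta> \<alpha> \<nu> z)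
      = (\<Sum>\<alpha>\<in>UNIV. \<Sum>\<beta>\<in>UNIV. gam \<alpha> \<beta> \<nu> z * gam \<beta> \<alpha> \<sigma> z)"
    by (subst sum.swap) (simp add: mult.commute)
  then show ?thesis
    unfolding dg by (simp add: sum.distrib sum_negf right_diff_distrib sum_subtractf)
qed

text \<open>The covector \<open>b\<close> enters as a premise, so that it can be matched with the
  torsion trace or half of it. The premise is an equation of functions because \<open>b\<close> gets
  differentiated.\<close>

lemma trace_W:
  assumes z: "z \<in> U" and G: "\<And>\<alpha> \<mu> \<nu>. G \<alpha> \<mu> \<nu> differentiable (at z)"
    and b: "b = (\<lambda>\<nu> z. \<Sum>\<alpha>\<in>UNIV. G \<alpha> \<alpha> \<nu> z - gam \<alpha> \<alpha> \<nu> z)"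
  shows "(\<Sum>\<alpha>\<in>UNIV. \<Sum>i\<in>UNIV. L i \<alpha> z * cov_comm d G (lam i) \<alpha> \<nu> \<sigma> z)
    = d \<nu> (b \<sigma>) z - d \<sigma> (b \<nu>) z + (\<Sum>\<epsilon>\<in>UNIV. b \<epsilon> z * (G \<epsilon> \<nu> \<sigma> z - G \<epsilon> \<sigma> \<nu> z))"
proof -
  \<comment> \<open>\<open>Y\<close> is the curvature part of the Ricci identity,
    \<open>\<tau>\<close> the torsion of \<open>G\<close>, and \<open>K\<close> the commutator
    part.\<close>
  define Y where "Y \<mu> \<epsilon> = d \<nu> (G \<epsilon> \<mu> \<sigma>) z - d \<sigma> (G \<epsilon> \<mu> \<nu>) z
        + (\<Sum>\<eta>\<in>UNIV. G \<epsilon> \<eta> \<nu> z * G \<eta> \<mu> \<sigma> z - G \<epsilon> \<eta> \<sigma> z * G \<eta> \<mu> \<nu> z)" for \<mu> \<epsilon>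
  define \<tau> where "\<tau> \<epsilon> = G \<epsilon> \<nu> \<sigma> z - G \<epsilon> \<sigma> \<nu> z" for \<epsilon>
  define K where "K i \<mu> = d \<sigma> (d \<nu> (lam i \<mu>)) z - d \<nu> (d \<sigma> (lam i \<mu>)) z" for i \<mu>
  have comm: "cov_comm d G (lam i) \<mu> \<nu> \<sigma> z = K i \<mu> + (\<Sum>\<epsilon>\<in>UNIV. lam i \<epsilon> z * Y \<mu> \<epsilon>)
     - (\<Sum>\<epsilon>\<in>UNIV. cov1 d G (lam i) \<mu> \<epsilon> z * \<tau> \<epsilon>)" for i \<mu>
    unfolding K_def Y_def \<tau>_def
    by (intro ricci_identity[OF directional_derivative_axioms] coframe_diff d_coframe_diff z G)
  \<comment> \<open>The derivative of the coframe contracts to \<open>gam\<close>, and duality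
    reduces the other part to \<open>G\<close>; this is where minus \<open>b\<close> arises after
    summing over \<alpha>.\<close>
  have cov: "(\<Sum>i\<in>UNIV. L i \<alpha> z * cov1 d G (lam i) \<alpha> \<epsilon> z) = gam \<alpha> \<alpha> \<epsilon> z - G \<alpha> \<alpha> \<epsilon> z" for \<alpha> \<epsilon>
    using contract_coframe[OF z, of \<alpha> "\<lambda>\<eta>. G \<eta> \<alpha> \<epsilon> z"]
    by (simp add: cov1_def gam_def right_diff_distrib sum_subtractf)
  have tors: "(\<Sum>i\<in>UNIV. L i \<alpha> z * (\<Sum>\<epsilon>\<in>UNIV. cov1 d G (lam i) \<alpha> \<epsilon> z * \<tau> \<epsilon>))
      = (\<Sum>\<epsilon>\<in>UNIV. (gam \<alpha> \<alpha> \<epsilon> z - G \<alpha> \<alpha> \<epsilon> z) * \<tau> \<epsilon>)" for \<alpha>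
    unfolding cov[symmetric] sum_distrib_left sum_distrib_right
    by (subst sum.swap) (simp add: mult.assoc)
  have tors': "(\<Sum>\<alpha>\<in>UNIV. \<Sum>\<epsilon>\<in>UNIV. (gam \<alpha> \<alpha> \<epsilon> z - G \<alpha> \<alpha> \<epsilon> z) * \<tau> \<epsilon>) = - (\<Sum>\<epsilon>\<in>UNIV. b \<epsilon> z * \<tau> \<epsilon>)"
    unfolding b sum_distrib_right
    by (subst sum.swap) (simp add: sum_negf[symmetric] left_diff_distrib)
  \<comment> \<open>The trace of a commutator of two matrices vanishes.\<close>
  have quad: "(\<Sum>\<alpha>\<in>UNIV. \<Sum>\<eta>\<in>UNIV. G \<alpha> \<eta> \<nu> z * G \<eta> \<alpha> \<sigma> z - G \<alpha> \<eta> \<sigma> z * G \<eta> \<alpha> \<nu> z) = 0"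
  proof -
    have "(\<Sum>\<alpha>\<in>UNIV. \<Sum>\<eta>\<in>UNIV. G \<alpha> \<eta> \<nu> z * G \<eta> \<alpha> \<sigma> z) = (\<Sum>\<alpha>\<in>UNIV. \<Sum>\<eta>\<in>UNIV. G \<alpha> \<eta> \<sigma> z * G \<eta> \<alpha> \<nu> z)"
      by (subst sum.swap) (simp add: mult.commute)
    then show ?thesis by (simp add: sum_subtractf)
  qed
  have db: "d \<nu> (b \<sigma>) z = (\<Sum>\<alpha>\<in>UNIV. d \<nu> (G \<alpha> \<alpha> \<sigma>) z) - (\<Sum>\<alpha>\<in>UNIV. d \<nu> (gam \<alpha> \<alpha> \<sigma>) z)" for \<nu> \<sigma>
    unfolding b using z by (simp add: d_sum d_diff G gam_diff differentiable_diff sum_subtractf)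
  have "(\<Sum>i\<in>UNIV. L i \<alpha> z * cov_comm d G (lam i) \<alpha> \<nu> \<sigma> z)
      = (\<Sum>i\<in>UNIV. L i \<alpha> z * K i \<alpha>) + Y \<alpha> \<alpha> - (\<Sum>\<epsilon>\<in>UNIV. (gam \<alpha> \<alpha> \<epsilon> z - G \<alpha> \<alpha> \<epsilon> z) * \<tau> \<epsilon>)" for \<alpha>
    unfolding comm right_diff_distrib distrib_left sum.distrib sum_subtractf
      contract_coframe[OF z] tors ..
  then have "(\<Sum>\<alpha>\<in>UNIV. \<Sum>i\<in>UNIV. L i \<alpha> z * cov_comm d G (lam i) \<alpha> \<nu> \<sigma> z)
      = (\<Sum>\<alpha>\<in>UNIV. \<Sum>i\<in>UNIV. L i \<alpha> z * K i \<alpha>) + (\<Sum>\<alpha>\<in>UNIV. Y \<alpha> \<alpha>) + (\<Sum>\<epsilon>\<in>UNIV. b \<epsilon> z * \<tau> \<epsilon>)"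
    by (simp add: sum.distrib sum_subtractf tors'[unfolded sum_subtractf])
  moreover have "(\<Sum>\<alpha>\<in>UNIV. Y \<alpha> \<alpha>)
      = (\<Sum>\<alpha>\<in>UNIV. d \<nu> (G \<alpha> \<alpha> \<sigma>) z) - (\<Sum>\<alpha>\<in>UNIV. d \<sigma> (G \<alpha> \<alpha> \<nu>) z)"
    unfolding Y_def sum.distrib quad by (simp add: sum_subtractf)
  ultimately show ?thesis
    using curl_gam_trace[OF z, of \<sigma> \<nu>] unfolding db K_def \<tau>_def by simp
qed

section \<open>The metric of the frame and its Christoffel coefficients\<close>

lemma gap_metric_sym: "gap_metric L \<mu> \<nu> = gap_metric L \<nu> \<mu>"
  by (simp add: gap_metric_def fun_eq_iff mult.commute)

text \<open>The proposed matrix is checked to be a right inverse, which suffices for square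
  matrices. The formula also makes differentiability of the inverse metric immediate.\<close>

lemma inv_gap_metric_eq:
  assumes "z \<in> U"
  shows "inv_gap_metric L \<alpha> \<beta> z = (\<Sum>i\<in>UNIV. L i \<alpha> z * L i \<beta> z)"
proof -
  have "(\<Sum>\<epsilon>\<in>UNIV. gap_metric L \<alpha> \<epsilon> z * (\<Sum>i\<in>UNIV. L i \<epsilon> z * L i \<beta> z)) = (if \<alpha> = \<beta> then 1 else 0)"
    for \<alpha> \<beta>
  proof -
    have "(\<Sum>\<epsilon>\<in>UNIV. gap_metric L \<alpha> \<epsilon> z * (\<Sum>i\<in>UNIV. L i \<epsilon> z * L i \<beta> z))
        = (\<Sum>j\<in>UNIV. lam j \<alpha> z * (\<Sum>\<epsilon>\<in>UNIV. lam j \<epsilon> z * (\<Sum>i\<in>UNIV. L i \<epsilon> z * L i \<beta> z)))"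
      unfolding gap_metric_def sum_distrib_left[of "lam _ \<alpha> z"] sum_distrib_right
      by (subst sum.swap) (simp add: mult.assoc)
    also have "\<dots> = (\<Sum>j\<in>UNIV. L j \<beta> z * lam j \<alpha> z)"
      unfolding contract_frame[OF assms] by (simp add: mult.commute)
    finally show ?thesis by (auto simp: coframe_frame[OF assms])
  qed
  then have "(\<chi> \<alpha> \<beta>. gap_metric L \<alpha> \<beta> z) ** (\<chi> \<alpha> \<beta>. \<Sum>i\<in>UNIV. L i \<alpha> z * L i \<beta> z) = mat 1"
    by (simp add: matrix_matrix_mult_def mat_def vec_eq_iff)
  then show ?thesis
    by (simp add: inv_gap_metric_def matrix_inv_eqI)
qed

lemma gap_metric_diff: "z \<in> U \<Longrightarrow> gap_metric L \<mu> \<nu> differentiable (at z)"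
  unfolding gap_metric_def[abs_def]
  by (auto intro!: differentiable_sum differentiable_mult coframe_diff)

lemma d_gap_metric:
  assumes "z \<in> U"
  shows "d \<nu> (gap_metric L \<alpha> \<beta>) z
    = (\<Sum>i\<in>UNIV. d \<nu> (lam i \<alpha>) z * lam i \<beta> z + lam i \<alpha> z * d \<nu> (lam i \<beta>) z)"
  unfolding gap_metric_def[abs_def] using assms by (simp add: d_sum_mult coframe_diff)

lemma d_gap_metric_diff:
  assumes "z \<in> U"
  shows "d \<nu> (gap_metric L \<alpha> \<beta>) differentiable (at z)"
  by (rule differentiable_transform_open[OF _ open_U assms d_gap_metric[symmetric]])
    (auto intro!: differentiable_sum differentiable_mult differentiable_add assms
      coframe_diff d_coframe_diff)

lemma inv_gap_metric_diff:
  assumes "z \<in> U"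
  shows "inv_gap_metric L \<alpha> \<beta> differentiable (at z)"
  by (rule differentiable_transform_open[OF _ open_U assms inv_gap_metric_eq[symmetric]])
    (auto intro!: differentiable_sum differentiable_mult frame_diff assms)

definition riem :: "'n \<Rightarrow> 'n \<Rightarrow> 'n \<Rightarrow> 'n tfun" where
  "riem \<alpha> \<mu> \<nu> z = 1/2 * (\<Sum>\<epsilon>\<in>UNIV. inv_gap_metric L \<alpha> \<epsilon> z *
     (d \<mu> (gap_metric L \<nu> \<epsilon>) z + d \<nu> (gap_metric L \<mu> \<epsilon>) z - d \<epsilon> (gap_metric L \<mu> \<nu>) z))"

lemma riem_sym: "riem \<alpha> \<mu> \<nu> z = riem \<alpha> \<nu> \<mu> z"
  by (simp add: riem_def gap_metric_sym[of \<mu> \<nu>] add.commute)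

lemma riem_diff: "z \<in> U \<Longrightarrow> riem \<alpha> \<mu> \<nu> differentiable (at z)"
  unfolding riem_def[abs_def]
  by (intro differentiable_sum differentiable_mult differentiable_add differentiable_diff ballI
      inv_gap_metric_diff d_gap_metric_diff differentiable_const finite)

text \<open>Both traces are the derivative of log |det \<lambda>|, because det g is the square of
  det \<lambda>. The proof reaches this without determinants, using only the product rule and
  symmetry, so the operators \<open>d \<nu>\<close> need not commute.\<close>

lemma riem_trace:
  assumes "z \<in> U"
  shows "(\<Sum>\<alpha>\<in>UNIV. riem \<alpha> \<alpha> \<nu> z) = (\<Sum>\<alpha>\<in>UNIV. gam \<alpha> \<alpha> \<nu> z)"
proof -
  let ?h = "\<lambda>\<alpha> \<epsilon>. inv_gap_metric L \<alpha> \<epsilon> z" and ?g = "gap_metric L"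
  \<comment> \<open>Writing the inverse metric as a sum of products of frame elements lets duality
    collapse the sum over \<epsilon>.\<close>
  have contr: "(\<Sum>\<epsilon>\<in>UNIV. ?h \<alpha> \<epsilon> * (\<Sum>i\<in>UNIV. lam i \<epsilon> z * d \<nu> (lam i \<alpha>) z)) = gam \<alpha> \<alpha> \<nu> z" for \<alpha>
  proof -
    have "(\<Sum>\<epsilon>\<in>UNIV. ?h \<alpha> \<epsilon> * (\<Sum>i\<in>UNIV. lam i \<epsilon> z * d \<nu> (lam i \<alpha>) z))
        = (\<Sum>i\<in>UNIV. (\<Sum>\<epsilon>\<in>UNIV. lam i \<epsilon> z * (\<Sum>j\<in>UNIV. L j \<epsilon> z * L j \<alpha> z)) * d \<nu> (lam i \<alpha>) z)"
      unfolding inv_gap_metric_eq[OF assms] sum_distrib_left[of "\<Sum>j\<in>UNIV. _ j"]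
        sum_distrib_right[of _ _ "d \<nu> _ z"]
      by (subst sum.swap) (simp add: ac_simps)
    also have "\<dots> = gam \<alpha> \<alpha> \<nu> z"
      unfolding contract_frame[OF assms] by (simp add: gam_def)
    finally show ?thesis .
  qed
  have h_sym: "?h \<alpha> \<epsilon> = ?h \<epsilon> \<alpha>" for \<alpha> \<epsilon>
    by (simp add: inv_gap_metric_eq[OF assms] mult.commute)
  \<comment> \<open>The first and third terms of the Christoffel bracket cancel under contraction
    with the symmetric inverse metric.\<close>
  have "(\<Sum>\<alpha>\<in>UNIV. \<Sum>\<epsilon>\<in>UNIV. ?h \<alpha> \<epsilon> * d \<alpha> (?g \<nu> \<epsilon>) z)
      = (\<Sum>\<alpha>\<in>UNIV. \<Sum>\<epsilon>\<in>UNIV. ?h \<alpha> \<epsilon> * d \<epsilon> (?g \<alpha> \<nu>) z)"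
    by (subst sum.swap) (simp add: h_sym gap_metric_sym[of \<nu>])
  then have "(\<Sum>\<alpha>\<in>UNIV. riem \<alpha> \<alpha> \<nu> z) = 1/2 * (\<Sum>\<alpha>\<in>UNIV. \<Sum>\<epsilon>\<in>UNIV. ?h \<alpha> \<epsilon> * d \<nu> (?g \<alpha> \<epsilon>) z)"
    unfolding riem_def sum_distrib_left[symmetric]
    by (simp add: distrib_left right_diff_distrib sum.distrib sum_subtractf)
  \<comment> \<open>The two terms of the product rule contribute equally, which absorbs the factor
    1/2.\<close>
  also have "(\<Sum>\<alpha>\<in>UNIV. \<Sum>\<epsilon>\<in>UNIV. ?h \<alpha> \<epsilon> * d \<nu> (?g \<alpha> \<epsilon>) z)
      = 2 * (\<Sum>\<alpha>\<in>UNIV. \<Sum>\<epsilon>\<in>UNIV. ?h \<alpha> \<epsilon> * (\<Sum>i\<in>UNIV. lam i \<epsilon> z * d \<nu> (lam i \<alpha>) z))"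
  proof -
    have "(\<Sum>\<alpha>\<in>UNIV. \<Sum>\<epsilon>\<in>UNIV. ?h \<alpha> \<epsilon> * (\<Sum>i\<in>UNIV. lam i \<alpha> z * d \<nu> (lam i \<epsilon>) z))
        = (\<Sum>\<alpha>\<in>UNIV. \<Sum>\<epsilon>\<in>UNIV. ?h \<alpha> \<epsilon> * (\<Sum>i\<in>UNIV. lam i \<epsilon> z * d \<nu> (lam i \<alpha>) z))"
      by (subst sum.swap) (simp add: h_sym)
    then show ?thesis
      by (simp add: d_gap_metric[OF assms] sum.distrib distrib_left mult.commute[of "d _ _ _"])
  qed
  finally show ?thesis by (simp add: contr)
qed

section \<open>W-traces of the dual, symmetric and Riemannian coefficients\<close>

lemma trace_W_dual:
  assumes z: "z \<in> U" and \<beta>: "\<beta> = torsion_trace (\<lambda>\<alpha> \<mu> \<nu> z. gam \<alpha> \<mu> \<nu> z - gam \<alpha> \<nu> \<mu> z)"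
  shows "(\<Sum>\<alpha>\<in>UNIV. \<Sum>i\<in>UNIV. L i \<alpha> z * cov_comm d (\<lambda>\<alpha> \<mu> \<nu>. gam \<alpha> \<nu> \<mu>) (lam i) \<alpha> \<nu> \<sigma> z)
    = d \<nu> (\<beta> \<sigma>) z - d \<sigma> (\<beta> \<nu>) z + (\<Sum>\<epsilon>\<in>UNIV. \<beta> \<epsilon> z * (gam \<epsilon> \<sigma> \<nu> z - gam \<epsilon> \<nu> \<sigma> z))"
  by (rule trace_W[OF z]) (auto simp: gam_diff z \<beta> torsion_trace_def fun_eq_iff)

text \<open>Passing from \<open>d\<close> to the canonical covariant derivative in the curl of
  \<beta> subtracts one torsion term; compensating for it doubles the one already present, whence
  the factor 2.\<close>

lemma trace_W_dual_cov1:
  assumes z: "z \<in> U" and \<beta>: "\<beta> = torsion_trace (\<lambda>\<alpha> \<mu> \<nu> z. gam \<alpha> \<mu> \<nu> z - gam \<alpha> \<nu> \<mu> z)"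
  shows "(\<Sum>\<alpha>\<in>UNIV. \<Sum>i\<in>UNIV. L i \<alpha> z * cov_comm d (\<lambda>\<alpha> \<mu> \<nu>. gam \<alpha> \<nu> \<mu>) (lam i) \<alpha> \<nu> \<sigma> z)
    = cov1 d gam \<beta> \<sigma> \<nu> z - cov1 d gam \<beta> \<nu> \<sigma> z
      + 2 * (\<Sum>\<epsilon>\<in>UNIV. \<beta> \<epsilon> z * (gam \<epsilon> \<sigma> \<nu> z - gam \<epsilon> \<nu> \<sigma> z))"
  unfolding trace_W_dual[OF assms] cov1_def
  by (simp add: right_diff_distrib sum_subtractf)

lemma torsion_trace_gam_diff:
  assumes "z \<in> U"
  shows "torsion_trace (\<lambda>\<alpha> \<mu> \<nu> z. gam \<alpha> \<mu> \<nu> z - gam \<alpha> \<nu> \<mu> z) \<nu> differentiable (at z)"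
  unfolding torsion_trace_def[abs_def] using assms
  by (auto intro!: differentiable_sum differentiable_diff gam_diff)

lemma trace_W_sym:
  assumes z: "z \<in> U" and \<beta>: "\<beta> = torsion_trace (\<lambda>\<alpha> \<mu> \<nu> z. gam \<alpha> \<mu> \<nu> z - gam \<alpha> \<nu> \<mu> z)"
  shows "(\<Sum>\<alpha>\<in>UNIV. \<Sum>i\<in>UNIV. L i \<alpha> z *
      cov_comm d (\<lambda>\<alpha> \<mu> \<nu> z. 1/2 * (gam \<alpha> \<mu> \<nu> z + gam \<alpha> \<nu> \<mu> z)) (lam i) \<alpha> \<nu> \<sigma> z)
    = 1/2 * (d \<nu> (\<beta> \<sigma>) z - d \<sigma> (\<beta> \<nu>) z)"
proof -
  let ?G = "\<lambda>\<alpha> \<mu> \<nu> z. 1/2 * (gam \<alpha> \<mu> \<nu> z + gam \<alpha> \<nu> \<mu> z)"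
  have G: "?G \<alpha> \<mu> \<nu> differentiable (at z)" for \<alpha> \<mu> \<nu>
    by (intro differentiable_mult differentiable_const differentiable_add gam_diff z)
  \<comment> \<open>Subtracting \<open>gam \<alpha> \<alpha> \<nu>\<close> from its average with
    \<open>gam \<alpha> \<nu> \<alpha>\<close> leaves half of their difference.\<close>
  have b: "(\<lambda>\<nu> z. 1/2 * \<beta> \<nu> z) = (\<lambda>\<nu> z. \<Sum>\<alpha>\<in>UNIV. ?G \<alpha> \<alpha> \<nu> z - gam \<alpha> \<alpha> \<nu> z)"
    unfolding \<beta> torsion_trace_def sum_distrib_left
    by (intro ext sum.cong) (simp_all add: field_simps)
  have "\<beta> \<nu> differentiable (at z)" for \<nu>
    unfolding \<beta> by (rule torsion_trace_gam_diff[OF z])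
  then have db: "d \<sigma> (\<lambda>z. 1/2 * \<beta> \<nu> z) z = 1/2 * d \<sigma> (\<beta> \<nu>) z" for \<sigma> \<nu>
    by (rule d_cmult)
  show ?thesis
    unfolding trace_W[where G = ?G, OF z G b] db by (simp add: add.commute diff_divide_distrib)
qed

lemma trace_W_riem:
  assumes z: "z \<in> U"
  shows "(\<Sum>\<alpha>\<in>UNIV. \<Sum>i\<in>UNIV. L i \<alpha> z * cov_comm d riem (lam i) \<alpha> \<nu> \<sigma> z) = 0"
proof -
  define b where "b = (\<lambda>\<nu> z. \<Sum>\<alpha>\<in>UNIV. riem \<alpha> \<alpha> \<nu> z - gam \<alpha> \<alpha> \<nu> z)"
  have b0: "b \<nu> y = 0" if "y \<in> U" for \<nu> y
    using riem_trace[OF that] by (simp add: b_def sum_subtractf)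
  \<comment> \<open>\<open>riem_trace\<close> makes \<open>b\<close> vanish throughout the open set
    \<open>U\<close>, so its derivatives at \<open>z\<close> vanish as well.\<close>
  have "d \<sigma> (\<lambda>_. 0) z = d \<sigma> (b \<nu>) z" for \<sigma> \<nu>
    by (rule d_cong[OF open_U z]) (auto simp: b0)
  then have "d \<sigma> (b \<nu>) z = 0" for \<sigma> \<nu> by simp
  then show ?thesis
    unfolding trace_W[where G = riem, OF z riem_diff[OF z] b_def] by (simp add: riem_sym[of _ \<nu> \<sigma>])
qed

end

section \<open>The horizontal and vertical derivatives in a chart\<close>

lemma smooth_on_differentiable:
  assumes "smooth_on S f" "x \<in> S"
  shows "f differentiable (at x)" "(\<lambda>x. frechet_derivative f (at x) v) differentiable (at x)"
proof -
  have "times_differentiable_on (Suc (Suc 0)) S f" using assms smooth_on_def by blast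
  then show "f differentiable (at x)" "(\<lambda>x. frechet_derivative f (at x) v) differentiable (at x)"
    using assms(2) by simp_all
qed

lemma directional_derivative_dy: "directional_derivative dy (\<lambda>\<nu> z. (0, axis \<nu> 1))"
  by unfold_locales (simp add: dy_def)

text \<open>Linearity of the Frechet derivative gathers the sum defining \<open>delta\<close> into a
  single horizontal direction at each point.\<close>

lemma directional_derivative_delta:
  fixes N :: "'n \<Rightarrow> 'n \<Rightarrow> 'n::finite tfun"
  shows "directional_derivative (delta N) (\<lambda>\<nu> z. (axis \<nu> 1, - (\<chi> \<alpha>. N \<alpha> \<nu> z)))"
proof
  fix f :: "'n tfun" and z \<nu>
  assume "f differentiable (at z)"
  then have lin: "linear (frechet_derivative f (at z))" by (rule linear_frechet_derivative)
  have "(\<chi> \<alpha>. N \<alpha> \<nu> z) = (\<Sum>\<alpha>\<in>UNIV. N \<alpha> \<nu> z *\<^sub>R axis \<alpha> 1)"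
    using basis_expansion[of "\<chi> \<alpha>. N \<alpha> \<nu> z"] by (simp add: scalar_mult_eq_scaleR)
  then have eq: "(axis \<nu> 1, - (\<chi> \<alpha>. N \<alpha> \<nu> z))
      = (axis \<nu> 1, 0) - (\<Sum>\<alpha>\<in>UNIV. N \<alpha> \<nu> z *\<^sub>R (0, axis \<alpha> 1))"
    by (simp add: prod_eq_iff fst_sum snd_sum)
  show "delta N \<nu> f z = frechet_derivative f (at z) (axis \<nu> 1, - (\<chi> \<alpha>. N \<alpha> \<nu> z))"
    unfolding delta_def dx_def dy_def
    by (simp only: eq linear_diff[OF lin] linear_sum[OF lin] linear_scale[OF lin] real_scaleR_def)
qed

lemma frame_calculus_dy:
  assumes "open U" "\<And>z. z \<in> U \<Longrightarrow> invertible (\<chi> j \<alpha>. L j \<alpha> z)" "\<And>i \<alpha>. smooth_on U (L i \<alpha>)"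
  shows "frame_calculus dy (\<lambda>\<nu> z. (0, axis \<nu> 1)) L U"
  using assms smooth_on_differentiable[OF assms(3)]
  by (intro frame_calculus.intro directional_derivative_dy frame_calculus_axioms.intro)
    (auto simp: dy_def[abs_def])

lemma frame_calculus_delta:
  assumes "open U" "\<And>z. z \<in> U \<Longrightarrow> invertible (\<chi> j \<alpha>. L j \<alpha> z)" "\<And>i \<alpha>. smooth_on U (L i \<alpha>)"
    and "\<And>\<alpha> \<beta>. smooth_on U (N \<alpha> \<beta>)"
  shows "frame_calculus (delta N) (\<lambda>\<nu> z. (axis \<nu> 1, - (\<chi> \<alpha>. N \<alpha> \<nu> z))) L U"
proof (intro frame_calculus.intro directional_derivative_delta frame_calculus_axioms.intro)
  fix z i \<alpha> \<nu> assume "z \<in> U"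
  then show "delta N \<nu> (L i \<alpha>) differentiable (at z)"
    unfolding delta_def[abs_def] dx_def dy_def
    using smooth_on_differentiable[OF assms(3)] smooth_on_differentiable[OF assms(4)]
    by (intro differentiable_diff differentiable_sum differentiable_mult) auto
qed (use assms smooth_on_differentiable[OF assms(3)] in auto)

text \<open>Left general in \<open>D\<close>, so that the dual, symmetric and Riemannian connections
  all reduce to the contracted commutator computed above.\<close>

lemma W_trace_hW:
  assumes "frame_calculus (delta (nlc D)) w L U" "z \<in> U"
  shows "W_trace (hW D L) \<nu> \<sigma> z = (\<Sum>\<alpha>\<in>UNIV. \<Sum>i\<in>UNIV.
     L i \<alpha> z * cov_comm (delta (nlc D)) (hcoef D) (coframe L i) \<alpha> \<nu> \<sigma> z)"
proof -
  interpret frame_calculus "delta (nlc D)" w L U by fact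
  have "hcov1 D X = cov1 (delta (nlc D)) (hcoef D) X" for X
    by (simp add: hcov1_def cov1_def fun_eq_iff)
  then show ?thesis
    unfolding W_trace_def hW_def W_tensor_eq[OF \<open>z \<in> U\<close>]
    by (simp add: cov_comm_def hcov2_def cov2_def)
qed

lemma W_trace_vW:
  assumes "frame_calculus dy w L U" "z \<in> U"
  shows "W_trace (vW D L) \<nu> \<sigma> z = (\<Sum>\<alpha>\<in>UNIV. \<Sum>i\<in>UNIV.
     L i \<alpha> z * cov_comm dy (vcoef D) (coframe L i) \<alpha> \<nu> \<sigma> z)"
proof -
  interpret frame_calculus dy w L U by fact
  have "vcov1 D X = cov1 dy (vcoef D) X" for X
    by (simp add: vcov1_def cov1_def fun_eq_iff)
  then show ?thesis
    unfolding W_trace_def vW_def W_tensor_eq[OF \<open>z \<in> U\<close>]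
    by (simp add: cov_comm_def vcov2_def cov2_def)
qed

section \<open>Tangent vectors with prescribed components\<close>

lemma chart_inj_on:
  assumes "smooth_manifold M A" "c \<in> A"
  shows "inj_on (snd c) (fst c)"
proof -
  have c: "openin M (fst c)"
      "homeomorphic_map (subtopology M (fst c)) (top_of_set (snd c ` fst c)) (snd c)"
    using assms by (auto simp: smooth_manifold_def is_chart_def)
  then show ?thesis
    by (metis homeomorphic_imp_injective_map openin_subset topspace_subtopology_subset)
qed

lemma open_chart_image:
  assumes "smooth_manifold M A" "c \<in> A" "openin M W" "W \<subseteq> fst c"
  shows "open (snd c ` W)"
proof -
  have c: "open (snd c ` fst c)"
      "homeomorphic_map (subtopology M (fst c)) (top_of_set (snd c ` fst c)) (snd c)"
    using assms by (auto simp: smooth_manifold_def is_chart_def)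
  have "openin (subtopology M (fst c)) W"
    using assms by (auto simp: openin_subtopology)
  then have "openin (top_of_set (snd c ` fst c)) (snd c ` W)"
    using homeomorphic_imp_open_map[OF c(2)] by (simp add: open_map_def)
  then show ?thesis
    using c(1) openin_open_trans by blast
qed

lemma transition_eq:
  assumes "smooth_manifold M A" "c \<in> A" "p \<in> fst c"
  shows "transition c c' (snd c p) = snd c' p"
  using chart_inj_on[OF assms(1,2)] assms(3) by (simp add: transition_def)

lemma transition_has_derivative:
  assumes "smooth_manifold M A" "c \<in> A" "c' \<in> A" "p \<in> fst c" "p \<in> fst c'"
  shows "(transition c c' has_derivative (*v) (jac c c' (snd c p))) (at (snd c p))"
proof -
  have "smooth_on (snd c ` (fst c \<inter> fst c')) (transition c c')"
    using assms unfolding smooth_manifold_def by blast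
  then have "transition c c' differentiable (at (snd c p))"
    by (rule smooth_on_differentiable) (use assms in auto)
  then show ?thesis unfolding jac_def using jacobian_works by blast
qed

lemma jac_refl:
  assumes "smooth_manifold M A" "c \<in> A" "p \<in> fst c"
  shows "jac c c (snd c p) = mat 1"
proof -
  have op: "open (snd c ` fst c)" "snd c p \<in> snd c ` fst c"
    using assms by (auto simp: smooth_manifold_def is_chart_def)
  have "((\<lambda>x. x) has_derivative (*v) (jac c c (snd c p))) (at (snd c p))"
    by (rule has_derivative_transform_within_open
        [OF transition_has_derivative[OF assms(1,2,2,3,3)] op])
      (use transition_eq[OF assms(1,2), of _ c] in auto)
  then have "(*v) (jac c c (snd c p)) = (\<lambda>x. x)"
    using has_derivative_ident has_derivative_unique by blast
  then show ?thesis
    unfolding matrix_eq by (metis matrix_vector_mul_lid)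
qed

text \<open>Chain rule: the composite transition agrees with the direct one on the image of the
  triple overlap, an open neighbourhood of \<open>snd c p\<close>.\<close>

lemma jac_cocycle:
  assumes M: "smooth_manifold M A" and c: "c \<in> A" "c' \<in> A" "c'' \<in> A"
    and p: "p \<in> fst c" "p \<in> fst c'" "p \<in> fst c''"
  shows "jac c c'' (snd c p) = jac c' c'' (snd c' p) ** jac c c' (snd c p)"
proof -
  let ?W = "fst c \<inter> fst c' \<inter> fst c''"
  have "openin M ?W"
    using M c by (intro openin_Int) (auto simp: smooth_manifold_def is_chart_def)
  then have op: "open (snd c ` ?W)" "snd c p \<in> snd c ` ?W"
    using open_chart_image[OF M c(1)] p by auto
  have "(transition c' c'' has_derivative (*v) (jac c' c'' (snd c' p))) (at (transition c c' (snd c p)))"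
    unfolding transition_eq[OF M c(1) p(1)] by (rule transition_has_derivative[OF M c(2,3) p(2,3)])
  from diff_chain_at[OF transition_has_derivative[OF M c(1,2) p(1,2)] this]
  have "(transition c c'' has_derivative (*v) (jac c' c'' (snd c' p)) \<circ> (*v) (jac c c' (snd c p)))
      (at (snd c p))"
    by (rule has_derivative_transform_within_open[OF _ op])
      (use transition_eq[OF M c(1), of _ c'] transition_eq[OF M c(1), of _ c'']
        transition_eq[OF M c(2), of _ c''] in auto)
  then have "(*v) (jac c c'' (snd c p)) = (*v) (jac c' c'' (snd c' p)) \<circ> (*v) (jac c c' (snd c p))"
    using has_derivative_unique[OF transition_has_derivative[OF M c(1,3) p(1,3)]] by blast
  then show ?thesis
    by (simp add: matrix_eq fun_eq_iff matrix_vector_mul_assoc)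
qed

text \<open>\<open>section_comp\<close> goes through \<open>inv_into\<close>, which is a true
  preimage only at points in the range of the induced coordinates. So a tangent vector with
  prescribed components in \<open>c\<close> has to be constructed.\<close>

lemma induced_coords_surj:
  fixes c :: "('m, 'n::finite) chart"
  assumes M: "smooth_manifold M A" and c: "c \<in> A" and z: "z \<in> induced_image c"
  shows "z \<in> induced_coords c ` induced_dom M A c"
proof -
  obtain p y where p: "p \<in> fst c" and z_eq: "z = (snd c p, y)"
    using z by (auto simp: induced_image_def)
  \<comment> \<open>The components \<open>y\<close> are transported from \<open>c\<close> by the
    Jacobians. The default 0 is the normalisation in \<open>tangent_space\<close>; the cocycle
    identity gives the transformation law.\<close>
  define v where "v c' = (if c' \<in> A \<and> p \<in> fst c' then jac c c' (snd c p) *v y else 0)" for c'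
  have law: "v c'' = jac c' c'' (snd c' p) *v v c'"
    if "c' \<in> A" "c'' \<in> A" "p \<in> fst c'" "p \<in> fst c''" for c' c''
    using jac_cocycle[OF M c that(1,2) p that(3,4)] that
    by (simp add: v_def matrix_vector_mul_assoc)
  have "v \<in> tangent_space A p"
    unfolding tangent_space_def by (intro CollectI conjI ballI allI impI law) (auto simp: v_def)
  moreover have "p \<in> topspace M"
    using M c p unfolding smooth_manifold_def by blast
  ultimately have "(p, v) \<in> induced_dom M A c"
    using p by (simp add: induced_dom_def tangent_bundle_def)
  moreover have "induced_coords c (p, v) = z"
    using jac_refl[OF M c p] c p by (simp add: induced_coords_def z_eq v_def)
  ultimately show ?thesis by force
qed

text \<open>Independence in a GAP-space concerns relations holding in all charts at once. A relation
  between components in \<open>c\<close> spreads to every chart around the point by the linear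
  transformation law, and elsewhere all components are 0; hence the rows of the frame matrix are
  independent.\<close>

lemma gap_space_frame_invertible:
  fixes c :: "('m, 'n::finite) chart"
  assumes gap: "gap_space M A lam" and c: "c \<in> A" and z: "z \<in> induced_image c"
  shows "invertible (\<chi> j \<alpha>. section_comp M A c (lam j) \<alpha> z)"
proof -
  define u where "u = inv_into (induced_dom M A c) (induced_coords c) z"
  have M: "smooth_manifold M A" using gap by (simp add: gap_space_def)
  have "u \<in> induced_dom M A c"
    unfolding u_def by (rule inv_into_into[OF induced_coords_surj[OF M c z]])
  then have u: "u \<in> tangent_bundle M A" "fst u \<in> fst c" by (auto simp: induced_dom_def)
  have lam: "lam i u \<in> tangent_space A (fst u)" for i
    using gap u(1) by (auto simp: gap_space_def pullback_section_def)
  have "a i = 0" if a: "(\<Sum>i\<in>UNIV. a i *s row i (\<chi> j \<alpha>. section_comp M A c (lam j) \<alpha> z)) = 0"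
    for a :: "'n \<Rightarrow> real" and i
  proof -
    have "row i (\<chi> j \<alpha>. section_comp M A c (lam j) \<alpha> z) = lam i u c" for i
      by (simp add: row_def section_comp_def u_def vec_eq_iff)
    then have a0: "(\<Sum>i\<in>UNIV. a i *\<^sub>R lam i u c) = 0"
      using a by (simp add: scalar_mult_eq_scaleR)
    have "(\<Sum>i\<in>UNIV. a i *\<^sub>R lam i u c') = 0" for c'
    proof (cases "c' \<in> A \<and> fst u \<in> fst c'")
      case True
      then have "lam i u c' = jac c c' (snd c (fst u)) *v lam i u c" for i
        using lam[of i] c u(2) unfolding tangent_space_def by blast
      then have "(\<Sum>i\<in>UNIV. a i *\<^sub>R lam i u c')
          = jac c c' (snd c (fst u)) *v (\<Sum>i\<in>UNIV. a i *\<^sub>R lam i u c)"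
        by (simp add: linear_sum[OF matrix_vector_mul_linear] matrix_vector_mult_scaleR)
      then show ?thesis using a0 by simp
    next
      case False
      then have "lam i u c' = 0" for i
        using lam[of i] unfolding tangent_space_def by blast
      then show ?thesis by simp
    qed
    then show ?thesis using gap u(1) unfolding gap_space_def by blast
  qed
  then have "\<exists>B. (\<chi> j \<alpha>. section_comp M A c (lam j) \<alpha> z) ** B = mat 1"
    unfolding matrix_right_invertible_independent_rows by blast
  then show ?thesis by (simp add: invertible_right_inverse)
qed

section \<open>The four trace formulas in an induced chart\<close>

theorem proposition7p3:
  fixes M :: "'m topology" and A :: "('m, 'n::finite) chart set"
    and lam :: "'n \<Rightarrow> 'm \<times> ('m, 'n) tvec \<Rightarrow> ('m, 'n) tvec"
    and N :: "('m, 'n) chart \<Rightarrow> 'n \<Rightarrow> 'n \<Rightarrow> 'n tfun"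
    and c :: "('m, 'n) chart" and z :: "(real ^ 'n) \<times> (real ^ 'n)" and \<nu> \<sigma> :: 'n
  assumes "gap_space M A lam"
    and "nonlinear_connection M A N"
    and "c \<in> A" and "z \<in> induced_image c"
  shows "let
      L = (\<lambda>i. section_comp M A c (lam i));
      D = canonical_dconn (N c) L;
      \<Lambda> = htorsion D; T = vtorsion D;
      \<beta> = torsion_trace \<Lambda>; B = torsion_trace T;
      Hdual = W_trace (hW (dual_dconn D) L);
      Vdual = W_trace (vW (dual_dconn D) L);
      Hsym = W_trace (hW (symmetric_dconn D) L);
      Hriem = W_trace (hW (riemannian_dconn (N c) L) L)
    in
      Hdual \<nu> \<sigma> z = hcov1 D \<beta> \<sigma> \<nu> z - hcov1 D \<beta> \<nu> \<sigma> z + 2 * (\<Sum>\<epsilon>\<in>UNIV. \<beta> \<epsilon> z * \<Lambda> \<epsilon> \<sigma> \<nu> z) \<and>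
      Vdual \<nu> \<sigma> z = vcov1 D B \<sigma> \<nu> z - vcov1 D B \<nu> \<sigma> z + 2 * (\<Sum>\<epsilon>\<in>UNIV. B \<epsilon> z * T \<epsilon> \<sigma> \<nu> z) \<and>
      Hsym \<nu> \<sigma> z = 1/2 * (Hdual \<nu> \<sigma> z + (\<Sum>\<epsilon>\<in>UNIV. \<beta> \<epsilon> z * \<Lambda> \<epsilon> \<nu> \<sigma> z)) \<and>
      Hriem \<nu> \<sigma> z = 0"
proof -
  define L where "L = (\<lambda>i. section_comp M A c (lam i))"
  define D where "D = canonical_dconn (N c) L"
  define U where "U = induced_image c"
  have z: "z \<in> U" using assms by (simp add: U_def)
  have open_U: "open U"
    using assms by (auto simp: U_def induced_image_def gap_space_def smooth_manifold_def
        is_chart_def intro!: open_Times)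
  have inv: "invertible (\<chi> j \<alpha>. L j \<alpha> z)" if "z \<in> U" for z
    using gap_space_frame_invertible[OF assms(1,3)] that by (simp add: L_def U_def)
  have L_smooth: "smooth_on U (L i \<alpha>)" for i \<alpha>
    using assms by (simp add: L_def U_def gap_space_def pullback_section_def)
  have N_smooth: "smooth_on U (N c \<alpha> \<beta>)" for \<alpha> \<beta>
    using assms by (simp add: U_def nonlinear_connection_def)
  note fch = frame_calculus_delta[where L = L, OF open_U inv L_smooth N_smooth]
  note fcv = frame_calculus_dy[where L = L, OF open_U inv L_smooth]
  \<comment> \<open>Two instances of one calculus: \<open>H.gam\<close> is \<Gamma> and
    \<open>V.gam\<close> is C, so (a) and (b) come from the same lemma.\<close>
  interpret H: frame_calculus "delta (N c)" "\<lambda>\<nu> z. (axis \<nu> 1, - (\<chi> \<alpha>. N c \<alpha> \<nu> z))" L U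
    by (rule fch)
  interpret V: frame_calculus dy "\<lambda>\<nu> z. (0, axis \<nu> 1)" L U
    by (rule fcv)
  have nlc [simp]: "nlc D = N c" "nlc (dual_dconn D) = N c" "nlc (symmetric_dconn D) = N c"
      "nlc (riemannian_dconn (N c) L) = N c"
    by (simp_all add: D_def canonical_dconn_def dual_dconn_def symmetric_dconn_def
        riemannian_dconn_def)
  have hc: "hcoef D = H.gam" and vc: "vcoef D = V.gam"
    by (simp_all add: D_def canonical_dconn_def H.gam_def V.gam_def fun_eq_iff)
  have hc': "hcoef (dual_dconn D) = (\<lambda>\<alpha> \<mu> \<nu>. H.gam \<alpha> \<nu> \<mu>)"
      "vcoef (dual_dconn D) = (\<lambda>\<alpha> \<mu> \<nu>. V.gam \<alpha> \<nu> \<mu>)"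
      "hcoef (symmetric_dconn D) = (\<lambda>\<alpha> \<mu> \<nu> z. 1/2 * (H.gam \<alpha> \<mu> \<nu> z + H.gam \<alpha> \<nu> \<mu> z))"
      "hcoef (riemannian_dconn (N c) L) = H.riem"
    by (simp_all add: dual_dconn_def symmetric_dconn_def riemannian_dconn_def hc vc
        H.riem_def fun_eq_iff)
  define \<beta> where "\<beta> = torsion_trace (htorsion D)"
  define B where "B = torsion_trace (vtorsion D)"
  have htor: "htorsion D = (\<lambda>\<alpha> \<mu> \<nu> z. H.gam \<alpha> \<mu> \<nu> z - H.gam \<alpha> \<nu> \<mu> z)"
    by (simp add: htorsion_def hc fun_eq_iff)
  have vtor: "vtorsion D = (\<lambda>\<alpha> \<mu> \<nu> z. V.gam \<alpha> \<mu> \<nu> z - V.gam \<alpha> \<nu> \<mu> z)"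
    by (simp add: vtorsion_def vc fun_eq_iff)
  note \<beta> = \<beta>_def[unfolded htor] and B = B_def[unfolded vtor]
  have hcov: "hcov1 D \<beta> = cov1 (delta (N c)) H.gam \<beta>"
    by (simp add: hcov1_def cov1_def hc fun_eq_iff)
  have vcov: "vcov1 D B = cov1 dy V.gam B"
    by (simp add: vcov1_def cov1_def vc fun_eq_iff)
  have Hdual: "W_trace (hW (dual_dconn D) L) \<nu> \<sigma> z = (\<Sum>\<alpha>\<in>UNIV. \<Sum>i\<in>UNIV.
      L i \<alpha> z * cov_comm (delta (N c)) (\<lambda>\<alpha> \<mu> \<nu>. H.gam \<alpha> \<nu> \<mu>) (coframe L i) \<alpha> \<nu> \<sigma> z)"
    using W_trace_hW[of "dual_dconn D", unfolded nlc, OF fch z] by (simp add: hc')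
  have Hsym: "W_trace (hW (symmetric_dconn D) L) \<nu> \<sigma> z
      = 1/2 * (delta (N c) \<nu> (\<beta> \<sigma>) z - delta (N c) \<sigma> (\<beta> \<nu>) z)"
    using W_trace_hW[of "symmetric_dconn D", unfolded nlc, OF fch z] H.trace_W_sym[OF z \<beta>]
    by (simp add: hc')
  have Vdual: "W_trace (vW (dual_dconn D) L) \<nu> \<sigma> z = vcov1 D B \<sigma> \<nu> z - vcov1 D B \<nu> \<sigma> z
      + 2 * (\<Sum>\<epsilon>\<in>UNIV. B \<epsilon> z * vtorsion D \<epsilon> \<sigma> \<nu> z)"
    using W_trace_vW[where D = "dual_dconn D", OF fcv z] V.trace_W_dual_cov1[OF z B]
    by (simp add: hc' vcov vtor)
  have Hriem: "W_trace (hW (riemannian_dconn (N c) L) L) \<nu> \<sigma> z = 0"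
    using W_trace_hW[of "riemannian_dconn (N c) L", unfolded nlc, OF fch z] H.trace_W_riem[OF z]
    by (simp add: hc')
  have "W_trace (hW (dual_dconn D) L) \<nu> \<sigma> z = hcov1 D \<beta> \<sigma> \<nu> z - hcov1 D \<beta> \<nu> \<sigma> z
      + 2 * (\<Sum>\<epsilon>\<in>UNIV. \<beta> \<epsilon> z * htorsion D \<epsilon> \<sigma> \<nu> z)"
    unfolding Hdual H.trace_W_dual_cov1[OF z \<beta>] hcov htor ..
  \<comment> \<open>The dual trace is the plain curl of \<beta> plus \<beta> contracted with the
    torsion. Adding the contraction with \<nu> and \<sigma> exchanged removes that term by
    antisymmetry, leaving twice the symmetric trace.\<close>
  moreover have "W_trace (hW (symmetric_dconn D) L) \<nu> \<sigma> z
      = 1/2 * (W_trace (hW (dual_dconn D) L) \<nu> \<sigma> z + (\<Sum>\<epsilon>\<in>UNIV. \<beta> \<epsilon> z * htorsion D \<epsilon> \<nu> \<sigma> z))"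
    unfolding Hdual H.trace_W_dual[OF z \<beta>] Hsym htor
    by (simp add: right_diff_distrib sum_subtractf)
  ultimately show ?thesis
    unfolding Let_def using Vdual Hriem unfolding \<beta>_def B_def D_def L_def by blast
qed

end
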